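(* Consider the two-lane Matérn hard-core vehicle model described in the context, in heavy traffic ($\lambda_p d_i\ge 1$ for $i\in\{1,2\}$), and let $\chi\in\{c_1,c_2\}$ indicate the antenna case. For a target SINR $\gamma_t$, let the coverage probability be $$\bar F^{\chi}_{\mathrm{SINR}}(\gamma_t)=\Pr\left[\frac{|h_{\mathbf{u}_{\mathrm{NV}}}|^2\,\|\mathbf{u}_{\mathrm{NV}}\|^{-\alpha}}{\sum_{\mathbf{u}\in\mathbb{U}_v^{\chi}\setminus\{\mathbf{u}_{\mathrm{NV}}\}}|h_{\mathbf{u}}|^2\,\|\mathbf{u}\|^{-\alpha}+\rho}>\gamma_t\right],$$ where $\rho=N/(P_tC)$. Then the coverage probability is inversely proportional to $\rho$, and the upper limit for $\bar F^{\chi}_{\mathrm{SINR}}$ is its value at $\rho=0$, namely $\bar F^{\chi}_{\mathrm{SINR}}\big|_{\rho=0}$.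
   Context: Type II Matérn hard-core process (MHCP) on $\mathbb{R}$ with hard-core distance $d$: it is generated from a Poisson point process (PPP) $\Phi_g$; each point $x\in\Phi_g$ is given a mark $m_x$ uniformly distributed in $[0,1]$, and the points $x$ retained are those with $m_x>m_{x'}$ for every other point $x'\in\Phi_g$ in the one-dimensional ball of radius $d$ centred at $x$. Two-lane model: vehicles in lane $i\in\{1,2\}$ are modeled by a one-dimensional type II MHCP $\Phi_i\subset\mathbb{R}$ with hard-core distance $d_i$ (the vehicle length plus the safety distance). The generating PPP for all MHCPs is $\Phi_p$, with density $\lambda_p$. A randomly selected typical vehicle in the first lane (the receiver) is fixed at the origin. The distance between the two lanes is $w_l$. The set of vehicle locations is $\mathbb{U}_v=\bigcup_{i=1}^{2}\bigcup_{x_i\in\Phi_i}\{(x_i,(i-1)w_l)\}\subset\mathbb{R}^2$, where the typical vehicle itself is not counted as a transmitter. Case $c_1$ (semicircle antennas, facing backwards when transmitting and forwards when receiving): $\mathbb{U}_v^{c_1}$ consists of the points of $\mathbb{U}_v$ with positive horizontal coordinate. Case $c_2$ (omnidirectional antennas): $\mathbb{U}_v^{c_2}=\mathbb{U}_v$. The typical vehicle is served by the nearest vehicle in the adjacent (second) lane, located at $\mathbf{u}_{\mathrm{NV}}=(x_{\mathrm{NV}},w_l)$, where $x_{\mathrm{NV}}$ minimizes $|x_2|$ over $x_2\in\Phi_2$ (over positive $x_2$ in case $c_1$). Signal model: $h_{\mathbf{u}}$ is the Rayleigh fading term of the link with transmitter at $\mathbf{u}$, with $|h_{\mathbf{u}_{\mathrm{NV}}}|^2$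 exponentially distributed with mean $1$; $\|\cdot\|$ is the Euclidean norm; $\alpha$ is the path loss exponent; $N$ is the noise power, $P_t$ the transmit power of all vehicles, and $C$ the free space path loss at a reference distance. The conclusion is read off from the approximation $$\bar F^{\chi}_{\mathrm{SINR}}(\gamma_t)\approx\int_{w_l}^{\infty}\exp\big(-\gamma_t(\rho+J_\chi)r^{\alpha}\big)f_r^{\chi}(r)\,dr,$$ where $f_r^{\chi}$ is the (approximate) probability density function of the communication distance $\|\mathbf{u}_{\mathrm{NV}}\|$ and $J_\chi$ is a quantity, not depending on $\rho$, that approximates the mean of the interference sum $\sum_{\mathbf{u}\in\mathbb{U}_v^{\chi}\setminus\{\mathbf{u}_{\mathrm{NV}}\}}|h_{\mathbf{u}}|^2\|\mathbf{u}\|^{-\alpha}$.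
   Formalization: "Inversely proportional to ρ" cannot hold literally (c/ρ is unbounded near 0, a probability is at most 1); it is replaced by: the coverage probability is decreasing in ρ ≥ 0, strictly so when the path loss exponent α exceeds 1. *)

theory Defs
  imports "HOL-Probability.Probability"
begin

datatype lane = Lane1 | Lane2

datatype antenna = Semicircle | Omnidirectional

section \<open>The marked Poisson processes and the fading\<close>

text \<open>
  A point process on the line is given by a measurable enumeration \<open>X 0, X 1, \<dots>\<close> of its points;
  \<open>card\<close> of an infinite set is 0, hence the explicit local finiteness.
  Counting indices rather than values makes the process almost surely simple.
\<close>

definition point_count :: "(nat \<Rightarrow> 'w \<Rightarrow> real) \<Rightarrow> real set \<Rightarrow> 'w \<Rightarrow> nat" where
  "point_count X B \<omega> = card {n. X n \<omega> \<in> B}"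

definition poisson_process :: "'w measure \<Rightarrow> real \<Rightarrow> (nat \<Rightarrow> 'w \<Rightarrow> real) \<Rightarrow> bool" where
  "poisson_process M lam X \<longleftrightarrow>
     (\<forall>n. X n \<in> borel_measurable M) \<and>
     (\<forall>B \<in> sets borel. bounded B \<longrightarrow>
        (AE \<omega> in M. finite {n. X n \<omega> \<in> B}) \<and>
        (\<forall>k. measure M {\<omega> \<in> space M. point_count X B \<omega> = k} =
             (lam * measure lborel B) ^ k / fact k * exp (- (lam * measure lborel B)))) \<and>
     (\<forall>\<B>. finite \<B> \<longrightarrow> disjoint \<B> \<longrightarrow> (\<forall>B \<in> \<B>. B \<in> sets borel \<and> bounded B) \<longrightarrow>
        prob_space.indep_vars M (\<lambda>_. count_space UNIV) (point_count X) \<B>)"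

text \<open>
  \<open>X i n\<close> and \<open>m i n\<close> are the position and the mark of the \<open>n\<close>-th point of the process generating
  lane \<open>i\<close>; \<open>h (i, n)\<close> is the complex fading coefficient of the link from that point to the receiver.
  Only one receiver, the typical vehicle, is ever considered, so that \<open>h\<close> is indexed by the
  transmitter alone. Nothing is assumed about the joint law of the two lanes: they may be generated
  by independent processes as well as by one and the same process, with common or separate marks.
\<close>

locale two_lane_model = prob_space M
  for M :: "'w measure" and lam :: real
    and X m :: "lane \<Rightarrow> nat \<Rightarrow> 'w \<Rightarrow> real"
    and h :: "lane \<times> nat \<Rightarrow> 'w \<Rightarrow> complex" +
  assumes points_poisson: "\<And>i. poisson_process M lam (X i)"
    and marks_indep: "\<And>i. indep_vars (\<lambda>_. borel) (m i) UNIV"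
    and marks_uniform: "\<And>i n. distr M borel (m i n) = uniform_measure lborel {0..1}"
    and marks_indep_points: "\<And>i. indep_var
          (Pi\<^sub>M UNIV (\<lambda>_. borel)) (\<lambda>\<omega> n. m i n \<omega>)
          (Pi\<^sub>M UNIV (\<lambda>_. borel)) (\<lambda>\<omega> n. X i n \<omega>)"
    and fading_indep: "indep_vars (\<lambda>_. borel) h UNIV"
    and fading_rayleigh:
          "\<And>u. distributed M lborel (\<lambda>\<omega>. (cmod (h u \<omega>))\<^sup>2) (exponential_density 1)"
    and fading_indep_points: "indep_set
          (sets (vimage_algebra (space M) (\<lambda>\<omega> u. h u \<omega>) (Pi\<^sub>M UNIV (\<lambda>_. borel))))
          (sets (vimage_algebra (space M) (\<lambda>\<omega> (i, n). (X i n \<omega>, m i n \<omega>))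
                   (Pi\<^sub>M UNIV (\<lambda>_. borel \<Otimes>\<^sub>M borel))))"

section \<open>Vehicles, transmitters and SINR of one configuration\<close>

text \<open>The indices of the points retained by the type II Matern thinning of the points \<open>x\<close>, marks \<open>m\<close>.\<close>

definition matern_II :: "real \<Rightarrow> (nat \<Rightarrow> real) \<Rightarrow> (nat \<Rightarrow> real) \<Rightarrow> nat set" where
  "matern_II d x m = {n. \<forall>k. k \<noteq> n \<and> x k \<in> ball (x n) d \<longrightarrow> m k < m n}"

text \<open>
  Below, \<open>r\<close> is the index of the receiver in the first lane; the receiver is moved to the origin.
\<close>

definition lane_offset :: "real \<Rightarrow> lane \<Rightarrow> real" where
  "lane_offset w i = (case i of Lane1 \<Rightarrow> 0 | Lane2 \<Rightarrow> w)"

definition location :: "real \<Rightarrow> (lane \<Rightarrow> nat \<Rightarrow> real) \<Rightarrow> nat \<Rightarrow> lane \<times> nat \<Rightarrow> real \<times> real" where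
  "location w x r u = (x (fst u) (snd u) - x Lane1 r, lane_offset w (fst u))"

definition transmitters :: "antenna \<Rightarrow> real \<Rightarrow> (lane \<Rightarrow> real) \<Rightarrow>
    (lane \<Rightarrow> nat \<Rightarrow> real) \<Rightarrow> (lane \<Rightarrow> nat \<Rightarrow> real) \<Rightarrow> nat \<Rightarrow> (lane \<times> nat) set" where
  "transmitters ant w d x m r =
     {u. snd u \<in> matern_II (d (fst u)) (x (fst u)) (m (fst u)) \<and> u \<noteq> (Lane1, r) \<and>
         (ant = Semicircle \<longrightarrow> 0 < fst (location w x r u))}"

definition nearest_adjacent :: "antenna \<Rightarrow> real \<Rightarrow> (lane \<Rightarrow> real) \<Rightarrow>
    (lane \<Rightarrow> nat \<Rightarrow> real) \<Rightarrow> (lane \<Rightarrow> nat \<Rightarrow> real) \<Rightarrow> nat \<Rightarrow> lane \<times> nat \<Rightarrow> bool" where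
  "nearest_adjacent ant w d x m r =
     is_arg_min (\<lambda>u. \<bar>fst (location w x r u)\<bar>) (\<lambda>u. u \<in> transmitters ant w d x m r \<and> fst u = Lane2)"

definition received_power :: "real \<Rightarrow> real \<Rightarrow> (lane \<Rightarrow> nat \<Rightarrow> real) \<Rightarrow>
    (lane \<times> nat \<Rightarrow> complex) \<Rightarrow> nat \<Rightarrow> lane \<times> nat \<Rightarrow> ennreal" where
  "received_power \<alpha> w x h r u = ennreal ((cmod (h u))\<^sup>2 * norm (location w x r u) powr (- \<alpha>))"

text \<open>
  Values in \<open>ennreal\<close>: a divergent interference sum is infinite and gives SINR 0, and a positive
  signal without interference and noise gives an infinite SINR.
\<close>

definition SINR :: "antenna \<Rightarrow> real \<Rightarrow> real \<Rightarrow> (lane \<Rightarrow> real) \<Rightarrow> real \<Rightarrow>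
    (lane \<Rightarrow> nat \<Rightarrow> real) \<Rightarrow> (lane \<Rightarrow> nat \<Rightarrow> real) \<Rightarrow> (lane \<times> nat \<Rightarrow> complex) \<Rightarrow>
    nat \<Rightarrow> lane \<times> nat \<Rightarrow> ennreal" where
  "SINR ant \<alpha> w d \<rho> x m h r v =
     received_power \<alpha> w x h r v /
     ((\<Sum>\<^sub>\<infinity>u \<in> transmitters ant w d x m r - {v}. received_power \<alpha> w x h r u) + ennreal \<rho>)"

text \<open>Two vehicles of the second lane are at the same minimal distance with probability 0 only.\<close>

definition covered :: "antenna \<Rightarrow> real \<Rightarrow> real \<Rightarrow> (lane \<Rightarrow> real) \<Rightarrow> real \<Rightarrow> real \<Rightarrow>
    (lane \<Rightarrow> nat \<Rightarrow> real) \<Rightarrow> (lane \<Rightarrow> nat \<Rightarrow> real) \<Rightarrow> (lane \<times> nat \<Rightarrow> complex) \<Rightarrow> nat \<Rightarrow> bool" where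
  "covered ant \<alpha> w d \<gamma> \<rho> x m h r \<longleftrightarrow>
     (\<exists>v. nearest_adjacent ant w d x m r v \<and> SINR ant \<alpha> w d \<rho> x m h r v > ennreal \<gamma>)"

section \<open>The coverage probability of the typical vehicle\<close>

text \<open>
  The probability that a typical point of a stationary process has a given property is the Palm
  probability: the mean number of points in the unit interval that have the property (seen from the
  point) divided by the mean number of points in the unit interval. Here this is the law of the
  typical vehicle of the first lane whenever the two lanes are jointly stationary.
\<close>

definition coverage_probability :: "'w measure \<Rightarrow>
    (lane \<Rightarrow> nat \<Rightarrow> 'w \<Rightarrow> real) \<Rightarrow> (lane \<Rightarrow> nat \<Rightarrow> 'w \<Rightarrow> real) \<Rightarrow> (lane \<times> nat \<Rightarrow> 'w \<Rightarrow> complex) \<Rightarrow>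
    antenna \<Rightarrow> real \<Rightarrow> real \<Rightarrow> (lane \<Rightarrow> real) \<Rightarrow> real \<Rightarrow> real \<Rightarrow> real" where
  "coverage_probability M X m h ant \<alpha> w d \<gamma> \<rho> =
     (let vehicles = (\<lambda>\<omega>. {r \<in> matern_II (d Lane1) (\<lambda>n. X Lane1 n \<omega>) (\<lambda>n. m Lane1 n \<omega>).
                           X Lane1 r \<omega> \<in> {0..1}})
      in (\<integral>\<omega>. real (card {r \<in> vehicles \<omega>.
               covered ant \<alpha> w d \<gamma> \<rho> (\<lambda>i n. X i n \<omega>) (\<lambda>i n. m i n \<omega>) (\<lambda>u. h u \<omega>) r}) \<partial>M) /
         (\<integral>\<omega>. real (card (vehicles \<omega>)) \<partial>M))"

end

theory Submission
  imports Defs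
begin

text \<open>
  Coverage means \<open>\<gamma> (I + \<rho>) < S\<close>, which becomes harder as \<open>\<rho>\<close> grows and, the inequality being
  strict, survives small noise; dominated convergence by the number of vehicles in the unit interval
  gives continuity at \<open>\<rho> = 0\<close>. Strictness for \<open>\<alpha> > 1\<close>: the interference is then almost surely finite,
  and a nearest vehicle exists because isolated points, which survive the thinning, occur arbitrarily
  far to the right; its independent exponential fading puts \<open>S\<close> between \<open>\<gamma> (I + \<rho>1)\<close> and
  \<open>\<gamma> (I + \<rho>2)\<close> with positive probability.
\<close>

text \<open>The obstacle is that nothing ties down the joint law of the two lanes. Of the geometry,
  therefore, only one event of merely positive probability is used, an isolated point of the first
  lane that becomes the receiver; whatever is asked of the second lane holds almost surely and so
  survives any coupling. Isolated points also avoid the law of the thinned process: they are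
  retained under every marking. A second difficulty is that receiver and server are random indices,
  whereas the independence of the fading concerns fixed links. Since there are only countably many
  indices, fixed ones can be chosen that still occur with positive probability, and the fading of
  the fixed server is then independent of everything else. The threshold \<alpha> = 1 is the
  dimension of the line: the series of \<open>(k + 1) powr (- \<alpha>)\<close> converges exactly
  for \<alpha> > 1. Finiteness of \<open>I\<close> is what separates the two thresholds; an infinite
  \<open>I\<close> would make both infinite.\<close>

instance lane :: countable
  by countable_datatype

section \<open>Measurability of sums over random index sets\<close>

lemma infsum_ennreal_nat:
  fixes f :: "nat \<Rightarrow> ennreal"
  shows "infsum f UNIV = (\<Sum>n. f n)"
  using has_sum_imp_sums[OF has_sum_infsum[OF nonneg_summable_on_complete[of UNIV f]]]
  by (simp add: sums_iff)

lemma infsum_ennreal_countable: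
  fixes f :: "'i::countable \<Rightarrow> ennreal"
  shows "infsum f UNIV = (\<Sum>n. if n \<in> range (to_nat :: 'i \<Rightarrow> nat) then f (from_nat n) else 0)"
proof -
  let ?g = "\<lambda>n. if n \<in> range (to_nat :: 'i \<Rightarrow> nat) then f (from_nat n) else 0"
  have "infsum f UNIV = infsum (?g \<circ> (to_nat :: 'i \<Rightarrow> nat)) UNIV"
    by (simp add: comp_def)
  also have "\<dots> = infsum ?g (range (to_nat :: 'i \<Rightarrow> nat))"
    by (rule infsum_reindex[symmetric]) simp
  also have "\<dots> = infsum ?g UNIV"
    by (rule infsum_cong_neutral) auto
  also have "\<dots> = (\<Sum>n. ?g n)"
    by (rule infsum_ennreal_nat)
  finally show ?thesis .
qed

text \<open>Moving the membership test into the summand turns a sum over a random set into a series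
  over a fixed index set. The hypothesis concerns the truncated summand: an index that is never
  selected contributes the constant 0, even if its own \<open>f i\<close> fails to be measurable.
  This is the situation of an excluded link whose fading is unknown to the sigma-algebra.\<close>

lemma borel_measurable_infsum_ennreal:
  fixes f :: "'i::countable \<Rightarrow> 'a \<Rightarrow> ennreal"
  assumes f[measurable]: "\<And>i. (\<lambda>x. if i \<in> A x then f i x else 0) \<in> borel_measurable N"
  shows "(\<lambda>x. \<Sum>\<^sub>\<infinity>i\<in>A x. f i x) \<in> borel_measurable N"
proof -
  have "(\<Sum>\<^sub>\<infinity>i\<in>A x. f i x) = (\<Sum>n. if n \<in> range (to_nat :: 'i \<Rightarrow> nat)
          then (if from_nat n \<in> A x then f (from_nat n) x else 0) else 0)" for x
    unfolding infsum_ennreal_countable[of "\<lambda>i. if i \<in> A x then f i x else 0", symmetric]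
    by (rule infsum_cong_neutral) auto
  then show ?thesis
    by simp
qed

section \<open>Coverage as a strict inequality without division\<close>

text \<open>A set \<open>A\<close> is removed, and not just the server, because two removals are
  needed: \<open>{v}\<close> gives the SINR denominator, and \<open>{v, v'}\<close> gives a quantity
  that involves the fading of neither \<open>v\<close> nor \<open>v'\<close>.\<close>

definition interference :: "antenna \<Rightarrow> real \<Rightarrow> real \<Rightarrow> (lane \<Rightarrow> real) \<Rightarrow>
    (lane \<Rightarrow> nat \<Rightarrow> real) \<Rightarrow> (lane \<Rightarrow> nat \<Rightarrow> real) \<Rightarrow> (lane \<times> nat \<Rightarrow> complex) \<Rightarrow>
    nat \<Rightarrow> (lane \<times> nat) set \<Rightarrow> ennreal" where
  "interference ant \<alpha> w d x m h r A =
     (\<Sum>\<^sub>\<infinity>u \<in> transmitters ant w d x m r - A. received_power \<alpha> w x h r u)"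

text \<open>The conventions of \<open>ennreal\<close> fit at the boundary: \<open>0 / 0 = 0\<close>,
  a positive signal divided by 0 is infinite, and a finite signal divided by infinity is 0, while
  \<open>ennreal g * top = top\<close> because \<open>0 < g\<close>.\<close>

lemma less_divide_ennreal_iff:
  fixes J :: ennreal
  assumes "0 < g" "0 \<le> s"
  shows "ennreal g < ennreal s / J \<longleftrightarrow> ennreal g * J < ennreal s"
proof (cases J)
  case (real j)
  show ?thesis
  proof (cases "j = 0")
    case True
    then show ?thesis
      using assms real by (cases "s = 0") (auto simp: ennreal_divide_zero less_top[symmetric] ennreal_zero_divide ennreal_divide_eq_top_iff order_less_le)
  next
    case False
    then show ?thesis
      using assms real
      by (auto simp: divide_ennreal ennreal_mult[symmetric] ennreal_less_iff field_simps)
  qed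
next
  case top
  then show ?thesis using assms by (auto simp: ennreal_mult_top)
qed

lemma covered_iff:
  assumes "0 < \<gamma>"
  shows "covered ant \<alpha> w d \<gamma> \<rho> x m h r \<longleftrightarrow>
    (\<exists>v. nearest_adjacent ant w d x m r v \<and>
       ennreal \<gamma> * (interference ant \<alpha> w d x m h r {v} + ennreal \<rho>) < received_power \<alpha> w x h r v)"
  unfolding covered_def SINR_def interference_def[symmetric]
  by (subst (1) received_power_def)
     (simp add: less_divide_ennreal_iff[OF assms] received_power_def)

lemma covered_antimono:
  assumes "0 < \<gamma>" "\<rho>1 \<le> \<rho>2" "covered ant \<alpha> w d \<gamma> \<rho>2 x m h r"
  shows "covered ant \<alpha> w d \<gamma> \<rho>1 x m h r"
proof -
  have "ennreal \<gamma> * (i + ennreal \<rho>1) \<le> ennreal \<gamma> * (i + ennreal \<rho>2)" for i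
    using assms(2) by (intro mult_left_mono add_left_mono ennreal_leI) auto
  then show ?thesis
    using assms(3) unfolding covered_iff[OF assms(1)] by (blast intro: le_less_trans)
qed

lemma covered_zero_imp_eventually:
  assumes "0 < \<gamma>" "covered ant \<alpha> w d \<gamma> 0 x m h r" "(\<rho> \<longlongrightarrow> 0) F"
  shows "eventually (\<lambda>n. covered ant \<alpha> w d \<gamma> (\<rho> n) x m h r) F"
proof -
  obtain v where v: "nearest_adjacent ant w d x m r v"
    "ennreal \<gamma> * (interference ant \<alpha> w d x m h r {v} + ennreal 0) < received_power \<alpha> w x h r v"
    using assms(2) unfolding covered_iff[OF assms(1)] by blast
  have "((\<lambda>n. ennreal \<gamma> * (interference ant \<alpha> w d x m h r {v} + ennreal (\<rho> n))) \<longlongrightarrow>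
         ennreal \<gamma> * (interference ant \<alpha> w d x m h r {v} + ennreal 0)) F"
    by (intro ennreal_tendsto_cmult tendsto_add tendsto_const tendsto_ennrealI assms(3)) auto
  from order_tendstoD(2)[OF this v(2)] show ?thesis
    by eventually_elim (use v(1) covered_iff[OF assms(1)] in blast)
qed

section \<open>Measurability\<close>

text \<open>The measurability facts are needed over the full sigma-algebra of the model and again
  over smaller ones that do not know the fading of a chosen link. \<open>A\<close> collects links
  whose fading may be unknown to \<open>N\<close>; positions and marks are always known.\<close>

locale measurable_configuration =
  fixes N :: "'w measure"
    and X m :: "lane \<Rightarrow> nat \<Rightarrow> 'w \<Rightarrow> real"
    and h :: "lane \<times> nat \<Rightarrow> 'w \<Rightarrow> complex"
    and A :: "(lane \<times> nat) set"
  assumes measurable_X[measurable]: "\<And>i n. X i n \<in> borel_measurable N"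
    and measurable_m[measurable]: "\<And>i n. m i n \<in> borel_measurable N"
    and measurable_h: "\<And>u. u \<notin> A \<Longrightarrow> h u \<in> borel_measurable N"
begin

abbreviation "points \<omega> \<equiv> \<lambda>i n. X i n \<omega>"
abbreviation "marks \<omega> \<equiv> \<lambda>i n. m i n \<omega>"
abbreviation "fading \<omega> \<equiv> \<lambda>u. h u \<omega>"

lemma pred_matern_II[measurable]:
  "Measurable.pred N (\<lambda>\<omega>. n \<in> matern_II d (points \<omega> i) (marks \<omega> i))"
  unfolding matern_II_def by simp

lemma measurable_location[measurable]:
  "(\<lambda>\<omega>. fst (location w (points \<omega>) r u)) \<in> borel_measurable N"
  "(\<lambda>\<omega>. norm (location w (points \<omega>) r u)) \<in> borel_measurable N"
  unfolding location_def by (simp_all add: norm_Pair)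

lemma pred_transmitters[measurable]:
  "Measurable.pred N (\<lambda>\<omega>. u \<in> transmitters ant w d (points \<omega>) (marks \<omega>) r)"
  unfolding transmitters_def by simp

lemma pred_nearest[measurable]:
  "Measurable.pred N (\<lambda>\<omega>. nearest_adjacent ant w d (points \<omega>) (marks \<omega>) r v)"
  unfolding nearest_adjacent_def is_arg_min_def by simp

lemma measurable_received_power:
  assumes "u \<notin> A"
  shows "(\<lambda>\<omega>. received_power \<alpha> w (points \<omega>) (fading \<omega>) r u) \<in> borel_measurable N"
proof -
  note [measurable] = measurable_h[OF assms]
  show ?thesis unfolding received_power_def by measurable
qed

lemma measurable_interference[measurable]:
  "(\<lambda>\<omega>. interference ant \<alpha> w d (points \<omega>) (marks \<omega>) (fading \<omega>) r A) \<in> borel_measurable N"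
  unfolding interference_def
proof (rule borel_measurable_infsum_ennreal)
  fix u
  show "(\<lambda>\<omega>. if u \<in> transmitters ant w d (points \<omega>) (marks \<omega>) r - A
            then received_power \<alpha> w (points \<omega>) (fading \<omega>) r u else 0) \<in> borel_measurable N"
  proof (cases "u \<in> A")
    case False
    note [measurable] = measurable_received_power[OF False]
    show ?thesis by measurable
  qed simp
qed

end

section \<open>Poisson processes\<close>

context prob_space
begin

context
  fixes lam :: real and X :: "nat \<Rightarrow> 'a \<Rightarrow> real"
  assumes poisson: "poisson_process M lam X" and lam_pos: "0 < lam"
begin

lemma poisson_measurable: "X n \<in> borel_measurable M"
  using poisson unfolding poisson_process_def by blast

lemma poisson_AE_finite:
  assumes "B \<in> sets borel" "bounded B"
  shows "AE \<omega> in M. finite {n. X n \<omega> \<in> B}"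
  using poisson assms unfolding poisson_process_def by blast

lemma poisson_prob_count:
  assumes "B \<in> sets borel" "bounded B"
  shows "prob {\<omega> \<in> space M. point_count X B \<omega> = k} =
             (lam * measure lborel B) ^ k / fact k * exp (- (lam * measure lborel B))"
  using poisson assms unfolding poisson_process_def by blast

lemma poisson_indep:
  assumes "finite \<B>" "disjoint \<B>" "\<And>B. B \<in> \<B> \<Longrightarrow> B \<in> sets borel \<and> bounded B"
  shows "indep_vars (\<lambda>_. count_space UNIV) (point_count X) \<B>"
  using poisson assms unfolding poisson_process_def by blast

lemma measurable_point_count:
  assumes "B \<in> sets borel"
  shows "point_count X B \<in> measurable M (count_space UNIV)"
proof -
  note [measurable] = assms poisson_measurable
  show ?thesis unfolding point_count_def[abs_def] by measurable
qed

lemma nn_integral_point_count: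
  assumes B: "B \<in> sets borel" "bounded B"
  shows "(\<integral>\<^sup>+\<omega>. of_nat (point_count X B \<omega>) \<partial>M) = ennreal (lam * measure lborel B)"
proof -
  note [measurable] = measurable_point_count[OF B(1)]
  define c where "c = lam * measure lborel B"
  have c: "0 \<le> c" using lam_pos by (simp add: c_def)
  define p where "p k = c ^ k / fact k * exp (- c)" for k
  have p: "0 \<le> p k" for k using c by (simp add: p_def)
  \<comment> \<open>The mean of a Poisson variable:
    \<open>real (Suc k) * p (Suc k) = c * p k\<close>, so the series for the mean is the exponential
    series shifted by one; its term at 0 vanishes.\<close>
  have "(\<lambda>k. c * exp (- c) * (c ^ k /\<^sub>R fact k)) sums (c * exp (- c) * exp c)"
    by (intro sums_mult exp_converges)
  moreover have "c * exp (- c) * (c ^ k /\<^sub>R fact k) = real (Suc k) * p (Suc k)" for k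
    by (simp add: p_def field_simps del: of_nat_Suc)
  ultimately have "(\<lambda>k. real (Suc k) * p (Suc k)) sums c"
    by (simp add: mult.assoc flip: exp_add)
  then have sums: "(\<lambda>k. real k * p k) sums c"
    by (subst (asm) sums_Suc_iff) simp
  have expand: "(\<Sum>k. of_nat k * indicator {k} n :: ennreal) = of_nat n" for n :: nat
    by (subst suminf_finite[of "{n}"]) auto
  have "(\<integral>\<^sup>+\<omega>. of_nat (point_count X B \<omega>) \<partial>M) =
      (\<integral>\<^sup>+\<omega>. (\<Sum>k. of_nat k * indicator {\<omega>\<in>space M. point_count X B \<omega> = k} \<omega>) \<partial>M)"
  proof (rule nn_integral_cong)
    fix \<omega> assume \<omega>: "\<omega> \<in> space M"
    then have "indicator {\<omega>\<in>space M. point_count X B \<omega> = k} \<omega> = (indicator {k} (point_count X B \<omega>) :: ennreal)" for k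
      by (simp add: indicator_def)
    then show "of_nat (point_count X B \<omega>) =
        (\<Sum>k. of_nat k * indicator {\<omega>\<in>space M. point_count X B \<omega> = k} \<omega> :: ennreal)"
      by (simp only: expand)
  qed
  also have "\<dots> = (\<Sum>k. of_nat k * emeasure M {\<omega>\<in>space M. point_count X B \<omega> = k})"
    by (subst nn_integral_suminf) (auto simp: nn_integral_cmult_indicator)
  also have "\<dots> = (\<Sum>k. ennreal (real k * p k))"
  proof (rule suminf_cong)
    fix k
    have "prob {\<omega>\<in>space M. point_count X B \<omega> = k} = p k"
      by (simp add: poisson_prob_count[OF B] p_def c_def)
    then show "of_nat k * emeasure M {\<omega>\<in>space M. point_count X B \<omega> = k} = ennreal (real k * p k)"
      by (simp add: emeasure_eq_measure ennreal_mult p ennreal_of_nat_eq_real_of_nat)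
  qed
  also have "\<dots> = ennreal c"
    using p by (intro suminf_ennreal_eq sums) auto
  finally show ?thesis by (simp add: c_def)
qed

text \<open>The law of a single \<open>X n\<close> is unknown, since the process is specified only
  through its counts. This sum over all indices is the one way from the counts to a sum over points,
  and feeds the bound on the interference.\<close>

lemma poisson_intensity:
  assumes B: "B \<in> sets borel" "bounded B"
  shows "(\<Sum>n. emeasure M {\<omega> \<in> space M. X n \<omega> \<in> B}) = ennreal (lam * measure lborel B)"
proof -
  note [measurable] = B(1) poisson_measurable
  have "(\<Sum>n. emeasure M {\<omega> \<in> space M. X n \<omega> \<in> B}) =
      (\<integral>\<^sup>+\<omega>. (\<Sum>n. indicator {\<omega> \<in> space M. X n \<omega> \<in> B} \<omega>) \<partial>M)"
    by (subst nn_integral_suminf) auto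
  also have "\<dots> = (\<integral>\<^sup>+\<omega>. of_nat (point_count X B \<omega>) \<partial>M)"
  proof (rule nn_integral_cong_AE)
    \<comment> \<open>Local finiteness is essential here: with infinitely many points in
      \<open>B\<close> the series would be infinite, but the count would be 0.\<close>
    show "AE \<omega> in M. (\<Sum>n. indicator {\<omega> \<in> space M. X n \<omega> \<in> B} \<omega> :: ennreal) = of_nat (point_count X B \<omega>)"
      using poisson_AE_finite[OF B] AE_space
    proof eventually_elim
      case (elim \<omega>)
      then have "(\<Sum>n. indicator {\<omega> \<in> space M. X n \<omega> \<in> B} \<omega> :: ennreal) =
          (\<Sum>n\<in>{n. X n \<omega> \<in> B}. 1)"
        by (subst suminf_finite[of "{n. X n \<omega> \<in> B}"]) (auto intro!: sum.cong)
      then show ?case by (simp add: point_count_def)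
    qed
  qed
  finally show ?thesis using nn_integral_point_count[OF B] by simp
qed

text \<open>A sufficient condition for a retained point that ignores the marks and only uses counts
  in two disjoint bounded Borel sets, so that its probability can be read off the Poisson law.
  Half-open intervals let neighbouring windows fit together without overlap.\<close>

definition isolated_point :: "real \<Rightarrow> real \<Rightarrow> 'a \<Rightarrow> bool" where
  "isolated_point d a \<omega> \<longleftrightarrow>
     point_count X {a..<a + 1} \<omega> = 1 \<and> point_count X ({a - d..<a} \<union> {a + 1..<a + 1 + d}) \<omega> = 0"

text \<open>The single point of the middle interval has no other point within distance
  \<open>d\<close>, so the condition on its mark is vacuous for every \<open>y\<close>. Finiteness
  is assumed because a count of 0 would also result from infinitely many points.\<close>

lemma isolated_point_matern:
  assumes "isolated_point d a \<omega>" "finite {n. X n \<omega> \<in> {a - d..<a} \<union> {a + 1..<a + 1 + d}}" "0 < d"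
  shows "\<exists>n \<in> matern_II d (\<lambda>n. X n \<omega>) y. X n \<omega> \<in> {a..<a + 1}"
proof -
  have "card {n. X n \<omega> \<in> {a..<a + 1}} = 1"
    using assms(1) by (simp add: isolated_point_def point_count_def)
  then obtain n where n: "{n. X n \<omega> \<in> {a..<a + 1}} = {n}"
    by (auto simp: card_1_singleton_iff)
  have empty: "{n. X n \<omega> \<in> {a - d..<a} \<union> {a + 1..<a + 1 + d}} = {}"
    using assms(1,2) by (simp add: isolated_point_def point_count_def)
  have "k = n" if "X k \<omega> \<in> ball (X n \<omega>) d" for k
  proof -
    have "X n \<omega> \<in> {a..<a + 1}" using n by blast
    with that have "X k \<omega> \<in> {a - d..<a + 1 + d}"
      by (auto simp: dist_real_def)
    with empty have "X k \<omega> \<in> {a..<a + 1}"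
      by force
    with n show ?thesis by blast
  qed
  moreover have "X n \<omega> \<in> {a..<a + 1}" using n by blast
  ultimately show ?thesis
    unfolding matern_II_def by blast
qed

lemma prob_isolated_point:
  assumes d: "0 < d"
  shows "prob {\<omega> \<in> space M. isolated_point d a \<omega>} = lam * exp (- lam) * exp (- (lam * (2 * d)))"
proof -
  let ?M = "{a..<a + 1}" and ?W = "{a - d..<a} \<union> {a + 1..<a + 1 + d}"
  have bnd: "bounded ?M" "bounded ?W"
    by (auto intro: bounded_subset[of "{a - d..a + 1 + d}"])
  have W: "measure lborel ?W = 2 * d"
    using d by (subst measure_Union) auto
  have ne: "?M \<noteq> ?W" and disj: "?M \<inter> ?W = {}" using d by auto
  have "indep_vars (\<lambda>_. count_space UNIV) (point_count X) {?M, ?W}"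
    using bnd disj by (intro poisson_indep) (auto simp: disjoint_def)
  then have "prob (\<Inter>B\<in>{?M, ?W}. point_count X B -` (if B = ?M then {1} else {0}) \<inter> space M) =
      (\<Prod>B\<in>{?M, ?W}. prob (point_count X B -` (if B = ?M then {1} else {0}) \<inter> space M))"
    by (rule indep_varsD_finite) auto
  also have "(\<Inter>B\<in>{?M, ?W}. point_count X B -` (if B = ?M then {1} else {0}) \<inter> space M) =
      {\<omega> \<in> space M. isolated_point d a \<omega>}"
    using ne by (auto simp: isolated_point_def)
  also have "(\<Prod>B\<in>{?M, ?W}. prob (point_count X B -` (if B = ?M then {1} else {0}) \<inter> space M)) =
      prob {\<omega> \<in> space M. point_count X ?M \<omega> = 1} * prob {\<omega> \<in> space M. point_count X ?W \<omega> = 0}"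
    using ne by (simp add: vimage_def Int_def conj_commute)
  finally show ?thesis
    using bnd by (simp add: poisson_prob_count W)
qed

lemma measurable_isolated_point: "Measurable.pred M (isolated_point d a)"
proof -
  note [measurable] = measurable_point_count
  show ?thesis unfolding isolated_point_def[abs_def] by measurable
qed

text \<open>The windows \<open>{a j - d..<a j + 1 + d}\<close> have length \<open>1 + 2 * d\<close>,
  which is also the spacing of the \<open>a j\<close>, so they are disjoint. The trials are thus
  independent with a common success probability \<open>q > 0\<close>, and the first \<open>n\<close>
  all fail with probability \<open>(1 - q) ^ n\<close>, which tends to 0.\<close>

lemma AE_isolated_point:
  assumes d: "0 < d"
  shows "AE \<omega> in M. \<exists>j::nat. isolated_point d (b + real j * (1 + 2 * d)) \<omega>"
proof -
  note [measurable] = measurable_isolated_point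
  define a where "a j = b + real j * (1 + 2 * d)" for j
  define I where "I j = {a j..<a j + 1}" for j
  define W where "W j = {a j - d..<a j} \<union> {a j + 1..<a j + 1 + d}" for j
  have a: "a j + (1 + 2 * d) \<le> a k" if "j < k" for j k
  proof -
    have "real j + 1 \<le> real k" using that by linarith
    then have "(real j + 1) * (1 + 2 * d) \<le> real k * (1 + 2 * d)"
      using d by (intro mult_right_mono) auto
    then show ?thesis by (simp add: a_def algebra_simps)
  qed
  have IW: "I j \<union> W j = {a j - d..<a j + 1 + d}" for j
    using d by (auto simp: I_def W_def)
  have IW_inter: "I j \<inter> W j = {}" for j
    by (auto simp: I_def W_def)
  have sep: "(I j \<union> W j) \<inter> (I k \<union> W k) = {}" if "j \<noteq> k" for j k
    using a[of j k] a[of k j] that unfolding IW by (cases "j < k") auto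
  \<comment> \<open>The counts are indexed by the sets themselves, so grouping them by windows
    requires disjoint families \<open>{I j, W j}\<close>. Disjoint sets differ only if they are not
    both empty.\<close>
  have ne: "I j \<noteq> {}" "W j \<noteq> {}" for j
    using d by (auto simp: I_def W_def)
  define q where "q = lam * exp (- lam) * exp (- (lam * (2 * d)))"
  have prob_q: "prob {\<omega> \<in> space M. isolated_point d (a j) \<omega>} = q" for j
    unfolding q_def by (rule prob_isolated_point[OF d])
  have q: "0 < q" "q \<le> 1"
  proof -
    show "0 < q" using lam_pos by (simp add: q_def)
    show "q \<le> 1" unfolding prob_q[of 0, symmetric] by (rule prob_le_1)
  qed
  have iso: "isolated_point d (a j) \<omega> \<longleftrightarrow> point_count X (I j) \<omega> = 1 \<and> point_count X (W j) \<omega> = 0" for j \<omega>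
    by (simp add: isolated_point_def I_def W_def)
  have bound: "prob {\<omega> \<in> space M. \<forall>j. \<not> isolated_point d (a j) \<omega>} \<le> (1 - q) ^ n" for n
  proof (cases "n = 0")
    case False
    let ?K = "\<lambda>j. {I j, W j}"
    let ?\<B> = "\<Union>j<n. ?K j"
    let ?N = "\<lambda>_::real set. count_space (UNIV :: nat set)"
    let ?Y = "\<lambda>j \<omega>. restrict (\<lambda>B. point_count X B \<omega>) (?K j)"
    let ?S = "\<lambda>j. {f \<in> space (Pi\<^sub>M (?K j) ?N). \<not> (f (I j) = 1 \<and> f (W j) = 0)}"
    have "indep_vars ?N (point_count X) ?\<B>"
    proof (rule poisson_indep)
      show "disjoint ?\<B>"
      proof (rule disjointI)
        fix A B assume "A \<in> ?\<B>" "B \<in> ?\<B>" and AB: "A \<noteq> B"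
        then obtain j k where jk: "A \<in> ?K j" "B \<in> ?K k" by blast
        show "A \<inter> B = {}"
        proof (cases "j = k")
          case True
          then show ?thesis using jk AB IW_inter[of k] by auto
        next
          case False
          then show ?thesis using jk sep[OF False] by auto
        qed
      qed
      fix B assume "B \<in> ?\<B>"
      then show "B \<in> sets borel \<and> bounded B"
        by (auto simp: I_def W_def)
    qed simp
    moreover have "disjoint_family_on ?K {..<n}"
      unfolding disjoint_family_on_def
    proof (intro ballI impI)
      fix j k :: nat assume "j \<noteq> k"
      then show "?K j \<inter> ?K k = {}"
        using sep[of j k] ne[of j] ne[of k] by auto
    qed
    ultimately have "indep_vars (\<lambda>j. Pi\<^sub>M (?K j) ?N) ?Y {..<n}"
      by (intro indep_vars_restrict[where I = ?\<B>]) auto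
    moreover have S[measurable]: "?S j \<in> sets (Pi\<^sub>M (?K j) ?N)" for j
    proof -
      have [measurable]: "(\<lambda>f. f (I j)) \<in> measurable (Pi\<^sub>M (?K j) ?N) (count_space UNIV)"
        "(\<lambda>f. f (W j)) \<in> measurable (Pi\<^sub>M (?K j) ?N) (count_space UNIV)"
        by (rule measurable_component_singleton; simp)+
      show ?thesis by measurable
    qed
    ultimately have "prob (\<Inter>j<n. ?Y j -` ?S j \<inter> space M) = (\<Prod>j<n. prob (?Y j -` ?S j \<inter> space M))"
      using False by (intro indep_varsD_finite) auto
    moreover have "?Y j -` ?S j \<inter> space M = space M - {\<omega> \<in> space M. isolated_point d (a j) \<omega>}" for j
      by (auto simp: iso space_PiM)
    moreover have "prob (space M - {\<omega> \<in> space M. isolated_point d (a j) \<omega>}) = 1 - q" for j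
      using prob_q by (subst prob_compl) auto
    ultimately have "prob (\<Inter>j<n. space M - {\<omega> \<in> space M. isolated_point d (a j) \<omega>}) = (1 - q) ^ n"
      by (simp only: prod_constant card_lessThan)
    moreover have "(\<Inter>j<n. space M - {\<omega> \<in> space M. isolated_point d (a j) \<omega>}) \<in> events"
      using False by (intro sets.finite_INT) auto
    then have "prob {\<omega> \<in> space M. \<forall>j. \<not> isolated_point d (a j) \<omega>} \<le>
        prob (\<Inter>j<n. space M - {\<omega> \<in> space M. isolated_point d (a j) \<omega>})"
      by (intro finite_measure_mono) auto
    ultimately show ?thesis by linarith
  qed simp
  have "(\<lambda>n. (1 - q) ^ n) \<longlonglongrightarrow> 0"
    using q by (intro LIMSEQ_realpow_zero) auto
  then have "prob {\<omega> \<in> space M. \<forall>j. \<not> isolated_point d (a j) \<omega>} \<le> 0"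
    by (rule LIMSEQ_le_const) (use bound in blast)
  then have "prob {\<omega> \<in> space M. \<forall>j. \<not> isolated_point d (a j) \<omega>} = 0"
    by (simp add: measure_le_0_iff)
  then have "AE \<omega> in M. \<not> (\<forall>j. \<not> isolated_point d (a j) \<omega>)"
    by (subst AE_iff_measurable[OF _ refl]) (auto simp: emeasure_eq_measure)
  then show ?thesis by (simp add: a_def)
qed

text \<open>All windows of the preceding lemma have their middle interval to the right of
  \<open>b\<close>, and an isolated point survives whatever marks \<open>y \<omega>\<close> it
  meets.\<close>

lemma AE_matern_point_beyond:
  assumes d: "0 < d"
  shows "AE \<omega> in M. \<exists>n \<in> matern_II d (\<lambda>n. X n \<omega>) (y \<omega>). b \<le> X n \<omega>"
proof -
  let ?a = "\<lambda>j::nat. b + real j * (1 + 2 * d)"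
  have "AE \<omega> in M. \<forall>j. finite {n. X n \<omega> \<in> {?a j - d..<?a j} \<union> {?a j + 1..<?a j + 1 + d}}"
    unfolding AE_all_countable
    by (intro allI poisson_AE_finite) auto
  with AE_isolated_point[OF d, of b] show ?thesis
  proof eventually_elim
    case (elim \<omega>)
    then obtain j where "isolated_point d (?a j) \<omega>" by blast
    from isolated_point_matern[OF this _ d] elim(2)
    obtain n where n: "n \<in> matern_II d (\<lambda>n. X n \<omega>) (y \<omega>)" "?a j \<le> X n \<omega>" by fastforce
    have "b \<le> ?a j" using d by simp
    with n show ?case by (meson order_trans)
  qed
qed

text \<open>
  Every shell \<open>k + 1 \<le> \<bar>y\<bar> < k + 2\<close> contains \<open>2 * lam\<close> points on average, so that the mean is dominated
  by the series of \<open>(k + 1) powr (- \<alpha>)\<close>.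
\<close>

lemma poisson_shot_noise_finite:
  assumes \<alpha>: "1 < \<alpha>"
  shows "(\<Sum>n. \<integral>\<^sup>+\<omega>. ennreal (if 2 \<le> \<bar>X n \<omega>\<bar> then (\<bar>X n \<omega>\<bar> / 2) powr (- \<alpha>) else 0) \<partial>M) < \<infinity>"
proof -
  define B where "B k = {y::real. real k + 1 \<le> \<bar>y\<bar> \<and> \<bar>y\<bar> < real k + 2}" for k
  have B_eq: "B k = {- (real k + 2)<..- (real k + 1)} \<union> {real k + 1..<real k + 2}" for k
    by (auto simp: B_def)
  have B: "B k \<in> sets borel" "bounded (B k)" for k
    by (auto simp: B_eq)
  have "measure lborel (B k) = 2" for k
    unfolding B_eq by (subst measure_Union) auto
  then have int: "(\<Sum>n. emeasure M {\<omega> \<in> space M. X n \<omega> \<in> B k}) = ennreal (2 * lam)" for k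
    using poisson_intensity[OF B, of k] by (simp add: mult.commute)
  note [measurable] = B(1) poisson_measurable
  define c where "c k = ((real k + 1) / 2) powr (- \<alpha>)" for k
  define g where "g y = ennreal (if 2 \<le> \<bar>y\<bar> then (\<bar>y\<bar> / 2) powr (- \<alpha>) else 0)" for y :: real
  have g: "g y \<le> (\<Sum>k. ennreal (c k) * indicator (B k) y)" for y
  proof (cases "2 \<le> \<bar>y\<bar>")
    case True
    define k where "k = nat \<lfloor>\<bar>y\<bar> - 1\<rfloor>"
    have k: "real k + 1 \<le> \<bar>y\<bar>" "\<bar>y\<bar> < real k + 2"
      using True unfolding k_def by linarith+
    have "g y \<le> ennreal (c k) * indicator (B k) y"
      using k True \<alpha> by (auto simp: g_def c_def B_def intro!: ennreal_leI powr_mono2')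
    also have "\<dots> = (\<Sum>i\<in>{k}. ennreal (c i) * indicator (B i) y)"
      by (simp only: sum.insert[OF finite.emptyI] sum.empty empty_iff not_False_eq_True add_0_right)
    also have "\<dots> \<le> (\<Sum>k. ennreal (c k) * indicator (B k) y)"
      by (rule sum_le_suminf) auto
    finally show ?thesis .
  qed (simp add: g_def)
  have "(\<Sum>n. \<integral>\<^sup>+\<omega>. g (X n \<omega>) \<partial>M) \<le>
      (\<Sum>n. \<integral>\<^sup>+\<omega>. (\<Sum>k. ennreal (c k) * indicator (B k) (X n \<omega>)) \<partial>M)"
    by (intro suminf_le nn_integral_mono g) auto
  also have "\<dots> = (\<Sum>n. \<Sum>k. ennreal (c k) * emeasure M {\<omega> \<in> space M. X n \<omega> \<in> B k})"
  proof (rule suminf_cong)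
    fix n
    have "(\<integral>\<^sup>+\<omega>. (\<Sum>k. ennreal (c k) * indicator (B k) (X n \<omega>)) \<partial>M) =
        (\<Sum>k. \<integral>\<^sup>+\<omega>. ennreal (c k) * indicator {\<omega> \<in> space M. X n \<omega> \<in> B k} \<omega> \<partial>M)"
      by (subst nn_integral_suminf)
         (auto intro!: suminf_cong nn_integral_cong simp: indicator_def)
    then show "(\<integral>\<^sup>+\<omega>. (\<Sum>k. ennreal (c k) * indicator (B k) (X n \<omega>)) \<partial>M) =
        (\<Sum>k. ennreal (c k) * emeasure M {\<omega> \<in> space M. X n \<omega> \<in> B k})"
      by (simp add: nn_integral_cmult_indicator)
  qed
  \<comment> \<open>Tonelli for a double series: the sum over \<open>n\<close> is read as an
    integral with respect to the counting measure.\<close>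
  also have "\<dots> = (\<Sum>k. \<Sum>n. ennreal (c k) * emeasure M {\<omega> \<in> space M. X n \<omega> \<in> B k})"
    using nn_integral_suminf[of "\<lambda>k n. ennreal (c k) * emeasure M {\<omega> \<in> space M. X n \<omega> \<in> B k}"
        "count_space UNIV"]
    unfolding nn_integral_count_space_nat by simp
  also have "\<dots> = (\<Sum>k. ennreal (c k) * ennreal (2 * lam))"
    by (simp add: int)
  also have "\<dots> = ennreal (\<Sum>k. c k * (2 * lam))"
  proof -
    \<comment> \<open>This is where \<alpha> > 1 enters.\<close>
    have "summable (\<lambda>k. real (Suc k) powr (- \<alpha>))"
      using \<alpha> by (subst summable_Suc_iff) (simp add: summable_real_powr_iff)
    then have "summable (\<lambda>k. real (Suc k) powr (- \<alpha>) * (1 / 2) powr (- \<alpha>) * (2 * lam))"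
      by (intro summable_mult2)
    also have "(\<lambda>k. real (Suc k) powr (- \<alpha>) * (1 / 2) powr (- \<alpha>) * (2 * lam)) = (\<lambda>k. c k * (2 * lam))"
      by (auto simp: c_def fun_eq_iff add.commute simp flip: powr_mult)
    finally have "summable (\<lambda>k. c k * (2 * lam))" .
    then have "(\<Sum>k. ennreal (c k * (2 * lam))) = ennreal (\<Sum>k. c k * (2 * lam))"
      using lam_pos by (intro suminf_ennreal2) (auto simp: c_def)
    then show ?thesis
      using lam_pos by (simp add: c_def ennreal_mult)
  qed
  also have "\<dots> < \<infinity>" by simp
  finally show ?thesis by (simp add: g_def)
qed

end

end

section \<open>Geometry of one configuration\<close>

text \<open>By local finiteness only finitely many candidates are at most as far away as
  \<open>u\<close>. A minimiser among them also beats every candidate that is farther than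
  \<open>u\<close>.\<close>

lemma nearest_adjacent_exists:
  assumes fin: "\<And>b. finite {n. \<bar>x Lane2 n\<bar> \<le> b}"
    and u: "u \<in> transmitters ant w d x m r" "fst u = Lane2"
  shows "\<exists>v. nearest_adjacent ant w d x m r v"
proof -
  let ?f = "\<lambda>u. \<bar>fst (location w x r u)\<bar>"
  let ?S = "{v. v \<in> transmitters ant w d x m r \<and> fst v = Lane2 \<and> ?f v \<le> ?f u}"
  have "?S \<subseteq> Pair Lane2 ` {n. \<bar>x Lane2 n\<bar> \<le> ?f u + \<bar>x Lane1 r\<bar>}"
    by (auto simp: location_def image_iff)
  then have "finite ?S"
    using fin finite_surj by blast
  moreover have "u \<in> ?S"
    using u by simp
  ultimately obtain v where "is_arg_min ?f (\<lambda>v. v \<in> ?S) v"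
    using ex_is_arg_min_if_finite[of ?S ?f] by blast
  then have "nearest_adjacent ant w d x m r v"
    unfolding nearest_adjacent_def is_arg_min_def by force
  then show ?thesis ..
qed

text \<open>Two indices at the same place lie in each other's ball, so each would need the strictly
  larger mark. This lets positions stand for indices when nearest vehicles are counted.\<close>

lemma matern_II_inj_on:
  assumes "0 < d"
  shows "inj_on x (matern_II d x m)"
proof (rule inj_onI, rule ccontr)
  fix n k assume "n \<in> matern_II d x m" "k \<in> matern_II d x m" "x n = x k" "n \<noteq> k"
  with assms have "m k < m n" "m n < m k"
    by (auto simp: matern_II_def)
  then show False by simp
qed

text \<open>All nearest vehicles share one distance to the receiver, which leaves two possible
  coordinates, one on either side, and each coordinate belongs to at most one retained
  index.\<close>

lemma nearest_adjacent_at_most_two: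
  assumes d: "0 < d Lane2" and v: "nearest_adjacent ant w d x m r v"
  shows "\<exists>v'. v' \<noteq> v \<and> (\<forall>u. nearest_adjacent ant w d x m r u \<longrightarrow> u \<in> {v, v'})"
proof (cases "\<exists>v'. v' \<noteq> v \<and> nearest_adjacent ant w d x m r v'")
  case True
  then obtain v' where v': "v' \<noteq> v" "nearest_adjacent ant w d x m r v'" by blast
  have same: "a = b" if "nearest_adjacent ant w d x m r a" "nearest_adjacent ant w d x m r b"
    "x Lane2 (snd a) = x Lane2 (snd b)" for a b
  proof -
    have "snd a \<in> matern_II (d Lane2) (x Lane2) (m Lane2)" "fst a = Lane2"
      "snd b \<in> matern_II (d Lane2) (x Lane2) (m Lane2)" "fst b = Lane2"
      using that(1,2) by (auto simp: nearest_adjacent_def is_arg_min_def transmitters_def)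
    with that(3) matern_II_inj_on[OF d, of "x Lane2" "m Lane2"] show ?thesis
      by (auto simp: inj_on_def prod_eq_iff)
  qed
  have dist: "\<bar>x Lane2 (snd a) - x Lane1 r\<bar> = \<bar>x Lane2 (snd b) - x Lane1 r\<bar>"
    if "nearest_adjacent ant w d x m r a" "nearest_adjacent ant w d x m r b" for a b
    using that unfolding nearest_adjacent_def is_arg_min_def location_def
    by (metis fst_conv linorder_neqE_linordered_idom)
  have "u \<in> {v, v'}" if u: "nearest_adjacent ant w d x m r u" for u
  proof (rule ccontr)
    assume "u \<notin> {v, v'}"
    then have "x Lane2 (snd u) \<noteq> x Lane2 (snd v)" "x Lane2 (snd u) \<noteq> x Lane2 (snd v')"
      "x Lane2 (snd v') \<noteq> x Lane2 (snd v)"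
      using same u v v' by blast+
    then show False
      using dist[OF u v] dist[OF u v'(2)] by linarith
  qed
  with v'(1) show ?thesis by blast
next
  case False
  \<comment> \<open>A unique nearest vehicle is given an arbitrary dummy rival, so that later
    arguments need no case distinction.\<close>
  moreover have "\<exists>v'. v' \<noteq> v"
    by (metis n_not_Suc_n snd_conv)
  ultimately show ?thesis by blast
qed

text \<open>
  A bound that does not depend on the receiver: seen from the unit interval, a point at \<open>y\<close> with
  \<open>2 \<le> \<bar>y\<bar>\<close> is at least \<open>\<bar>y\<bar> / 2\<close> away.
\<close>

definition far_power :: "real \<Rightarrow> (lane \<Rightarrow> nat \<Rightarrow> real) \<Rightarrow> (lane \<times> nat \<Rightarrow> complex) \<Rightarrow> lane \<times> nat \<Rightarrow> ennreal"
  where "far_power \<alpha> x h u = ennreal ((cmod (h u))\<^sup>2) *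
    ennreal (if 2 \<le> \<bar>x (fst u) (snd u)\<bar> then (\<bar>x (fst u) (snd u)\<bar> / 2) powr (- \<alpha>) else 0)"

lemma received_power_le_far_power:
  assumes "0 < \<alpha>" "x Lane1 r \<in> {0..1}" "2 \<le> \<bar>x (fst u) (snd u)\<bar>"
  shows "received_power \<alpha> w x h r u \<le> far_power \<alpha> x h u"
proof -
  have "\<bar>x (fst u) (snd u)\<bar> / 2 \<le> \<bar>fst (location w x r u)\<bar>"
    using assms(2,3) unfolding location_def fst_conv atLeastAtMost_iff by arith
  also have "\<dots> \<le> norm (location w x r u)"
    by (metis norm_fst_le prod.collapse real_norm_def)
  finally have "norm (location w x r u) powr (- \<alpha>) \<le> (\<bar>x (fst u) (snd u)\<bar> / 2) powr (- \<alpha>)"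
    using assms by (intro powr_mono2') auto
  then show ?thesis
    using assms(3) unfolding received_power_def far_power_def
    by (simp add: ennreal_mult[symmetric] mult_left_mono ennreal_leI)
qed

text \<open>The near points are finitely many and each contributes a finite power, even at distance
  0, where \<open>powr\<close> yields 0; the far ones are dominated by
  \<open>far_power\<close>.\<close>

lemma interference_finite:
  assumes "0 < \<alpha>" "x Lane1 r \<in> {0..1}"
    and fin: "finite {u. \<bar>x (fst u) (snd u)\<bar> < 2}"
    and far: "infsum (far_power \<alpha> x h) UNIV < \<infinity>"
  shows "interference ant \<alpha> w d x m h r A < \<infinity>"
proof -
  let ?near = "{u. \<bar>x (fst u) (snd u)\<bar> < 2}"
  let ?R = "received_power \<alpha> w x h r"
  have "interference ant \<alpha> w d x m h r A \<le> infsum ?R (?near \<union> - ?near)"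
    unfolding interference_def
    by (intro infsum_mono_neutral nonneg_summable_on_complete) auto
  also have "\<dots> = infsum ?R ?near + infsum ?R (- ?near)"
    by (intro infsum_Un_disjoint nonneg_summable_on_complete) auto
  also have "infsum ?R (- ?near) \<le> infsum (far_power \<alpha> x h) UNIV"
    using received_power_le_far_power[where \<alpha> = \<alpha> and x = x and r = r, OF assms(1,2)]
    by (intro infsum_mono_neutral nonneg_summable_on_complete) auto
  also have "infsum ?R ?near = sum ?R ?near"
    by (rule infsum_finite[OF fin])
  finally have "interference ant \<alpha> w d x m h r A \<le> sum ?R ?near + infsum (far_power \<alpha> x h) UNIV"
    by (simp add: add_left_mono)
  also have "\<dots> < \<infinity>"
    using fin far by (auto simp: received_power_def sum_ennreal ennreal_add_eq_top less_top[symmetric])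
  finally show ?thesis .
qed

text \<open>Countably many null sets cannot cover an event of positive probability. This trades a
  random choice for a fixed one, first for receiver, server and rival, later for a pair of rational
  bounds.\<close>

lemma (in prob_space) exists_positive_prob:
  fixes F :: "'i::countable \<Rightarrow> 'a set"
  assumes E: "E \<in> events" "0 < prob E" and F: "\<And>i. F i \<in> events"
    and cover: "AE \<omega> in M. \<omega> \<in> E \<longrightarrow> (\<exists>i. \<omega> \<in> F i)"
  shows "\<exists>i. 0 < prob (F i)"
proof (rule ccontr)
  assume "\<nexists>i. 0 < prob (F i)"
  then have "prob (F i) = 0" for i
    using measure_nonneg[of M "F i"] by (metis less_eq_real_def)
  then have "AE \<omega> in M. \<forall>i. \<omega> \<notin> F i"
    unfolding AE_all_countable using prob_eq_0[OF F] by blast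
  with cover have "AE \<omega> in M. \<omega> \<notin> E"
    by eventually_elim blast
  then have "prob E = 0"
    using prob_eq_0[OF E(1)] by blast
  with E(2) show False by simp
qed

text \<open>Restores one excluded link at the cost of one finite summand. It is only an inequality
  because \<open>v\<close> may belong to \<open>A\<close> or fail to transmit.\<close>

lemma interference_insert_le:
  "interference ant \<alpha> w d x m h r A \<le>
     interference ant \<alpha> w d x m h r (insert v A) + received_power \<alpha> w x h r v"
proof -
  let ?T = "transmitters ant w d x m r" and ?R = "received_power \<alpha> w x h r"
  have "interference ant \<alpha> w d x m h r A \<le> infsum ?R ((?T - insert v A) \<union> {v})"
    unfolding interference_def
    by (intro infsum_mono_neutral nonneg_summable_on_complete) auto
  also have "\<dots> = infsum ?R (?T - insert v A) + infsum ?R {v}"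
    by (intro infsum_Un_disjoint nonneg_summable_on_complete) auto
  finally show ?thesis
    by (simp add: interference_def)
qed

text \<open>The gap between the lanes keeps the server away from the receiver; for a positive gap
  the path loss is then positive and at most \<open>w powr (- \<alpha>)\<close>.\<close>

lemma norm_location_adjacent:
  "fst v = Lane2 \<Longrightarrow> \<bar>w\<bar> \<le> norm (location w x r v)"
  using norm_snd_le[of "snd (location w x r v)" "fst (location w x r v)"]
  by (simp add: location_def lane_offset_def)

section \<open>The random model\<close>

context two_lane_model
begin

section \<open>Independence of one fading coefficient from all the other randomness\<close>

definition geometry_algebra :: "'w measure" where
  "geometry_algebra = vimage_algebra (space M) (\<lambda>\<omega> (i, n). (X i n \<omega>, m i n \<omega>))
     (Pi\<^sub>M UNIV (\<lambda>_. borel \<Otimes>\<^sub>M borel))"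

definition fading_algebra :: "'w measure" where
  "fading_algebra = vimage_algebra (space M) (\<lambda>\<omega> u. h u \<omega>) (Pi\<^sub>M UNIV (\<lambda>_. borel))"

lemma indep_fading_geometry: "indep_set (sets fading_algebra) (sets geometry_algebra)"
  using fading_indep_points unfolding fading_algebra_def geometry_algebra_def .

lemma space_algebras[simp]:
  "space geometry_algebra = space M" "space fading_algebra = space M"
  by (simp_all add: geometry_algebra_def fading_algebra_def)

lemma measurable_geometry_algebra:
  "X i n \<in> borel_measurable geometry_algebra" "m i n \<in> borel_measurable geometry_algebra"
proof -
  have 1: "(\<lambda>\<omega> (i, n). (X i n \<omega>, m i n \<omega>)) \<in> geometry_algebra \<rightarrow>\<^sub>M Pi\<^sub>M UNIV (\<lambda>_. borel \<Otimes>\<^sub>M borel)"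
    unfolding geometry_algebra_def
    by (rule measurable_vimage_algebra1) (auto simp: space_PiM space_pair_measure)
  have 2: "(\<lambda>f. f (i, n)) \<in> Pi\<^sub>M UNIV (\<lambda>_. borel \<Otimes>\<^sub>M borel) \<rightarrow>\<^sub>M borel \<Otimes>\<^sub>M borel"
    by (rule measurable_component_singleton) simp
  have 3: "(\<lambda>\<omega>. (X i n \<omega>, m i n \<omega>)) \<in> geometry_algebra \<rightarrow>\<^sub>M borel \<Otimes>\<^sub>M borel"
    using measurable_compose[OF 1 2] by simp
  show "X i n \<in> borel_measurable geometry_algebra" "m i n \<in> borel_measurable geometry_algebra"
    using measurable_compose[OF 3 measurable_fst] measurable_compose[OF 3 measurable_snd] by simp_all
qed

lemma measurable_fading_algebra: "h u \<in> borel_measurable fading_algebra"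
proof -
  have 1: "(\<lambda>\<omega> u. h u \<omega>) \<in> fading_algebra \<rightarrow>\<^sub>M Pi\<^sub>M UNIV (\<lambda>_. borel)"
    unfolding fading_algebra_def by (rule measurable_vimage_algebra1) (auto simp: space_PiM)
  have 2: "(\<lambda>f. f u) \<in> Pi\<^sub>M UNIV (\<lambda>_. borel) \<rightarrow>\<^sub>M borel"
    by (rule measurable_component_singleton) simp
  show ?thesis
    using measurable_compose[OF 1 2] by simp
qed

lemma measurable_model: "measurable_configuration M X m h {}"
proof
  show "X i n \<in> borel_measurable M" for i n
    using points_poisson unfolding poisson_process_def by blast
  show "m i n \<in> borel_measurable M" for i n
    using marks_indep unfolding indep_vars_def by blast
  show "h u \<in> borel_measurable M" for u
    using fading_indep unfolding indep_vars_def by blast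
qed

sublocale measurable_configuration M X m h "{}"
  by (rule measurable_model)

lemma measurable_fading[measurable]: "h u \<in> borel_measurable M"
  by (rule measurable_h) simp

text \<open>The type \<open>option\<close> adds one index to the links: \<open>None\<close> stands
  for the whole geometry, whose positions and marks need not be independent of each other across the
  lanes, and \<open>Some u\<close> for the fading of the single link \<open>u\<close>.\<close>

definition sources :: "(lane \<times> nat) option \<Rightarrow> 'w set set" where
  "sources = case_option (sets geometry_algebra) (\<lambda>u. {h u -` B \<inter> space M | B. B \<in> sets borel})"

text \<open>Two assumptions combine. The links are mutually independent, which factorises a finite
  intersection \<open>H\<close> of fading events; and \<open>H\<close> belongs to
  \<open>fading_algebra\<close>, which as a whole is independent of the geometry, so that a
  geometric event splits off as a further factor.\<close>

lemma indep_sources: "indep_sets sources UNIV"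
proof (rule indep_setsI)
  show "sources j \<subseteq> events" for j
    using indep_setD_ev2[OF indep_fading_geometry]
    by (cases j) (auto simp: sources_def intro!: measurable_sets[OF measurable_fading])
next
  fix A :: "(lane \<times> nat) option \<Rightarrow> 'w set" and J
  assume J: "J \<noteq> {}" "finite J" and A: "\<forall>j\<in>J. A j \<in> sources j"
  define K where "K = {u. Some u \<in> J}"
  have K: "finite K"
    using finite_vimageI[OF J(2), of Some] by (simp add: K_def vimage_def)
  have "\<forall>u\<in>K. \<exists>B. B \<in> sets borel \<and> A (Some u) = h u -` B \<inter> space M"
  proof
    fix u assume "u \<in> K"
    then have "A (Some u) \<in> sources (Some u)"
      using A by (auto simp: K_def)
    then show "\<exists>B. B \<in> sets borel \<and> A (Some u) = h u -` B \<inter> space M"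
      by (auto simp: sources_def)
  qed
  then obtain B where B: "\<And>u. u \<in> K \<Longrightarrow> B u \<in> sets borel"
    "\<And>u. u \<in> K \<Longrightarrow> A (Some u) = h u -` B u \<inter> space M"
    by metis
  define H where "H = {\<omega> \<in> space M. \<forall>u\<in>K. h u \<omega> \<in> B u}"
  have H_sets: "H \<in> sets fading_algebra"
  proof -
    have "{\<omega> \<in> space fading_algebra. h u \<omega> \<in> B u} \<in> sets fading_algebra" if "u \<in> K" for u
    proof -
      note [measurable] = B(1)[OF that] measurable_fading_algebra
      show ?thesis by measurable
    qed
    then have "{\<omega> \<in> space fading_algebra. \<forall>u\<in>K. h u \<omega> \<in> B u} \<in> sets fading_algebra"
      using K by (intro sets.sets_Collect_finite_All)
    then show ?thesis by (simp add: H_def)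
  qed
  have H_prob: "prob H = (\<Prod>u\<in>K. prob (A (Some u)))"
  proof (cases "K = {}")
    case True
    then show ?thesis by (simp add: H_def prob_space)
  next
    case False
    have "prob (\<Inter>u\<in>K. h u -` B u \<inter> space M) = (\<Prod>u\<in>K. prob (h u -` B u \<inter> space M))"
      by (rule indep_varsD[OF fading_indep False K]) (use B in auto)
    also have "(\<Inter>u\<in>K. h u -` B u \<inter> space M) = H"
      using False by (auto simp: H_def)
    finally show ?thesis using B(2) by simp
  qed
  show "prob (\<Inter>(A ` J)) = (\<Prod>j\<in>J. prob (A j))"
  proof (cases "None \<in> J")
    case True
    have "j \<in> J \<longleftrightarrow> j \<in> insert None (Some ` K)" for j
      using True by (cases j) (auto simp: K_def)
    then have J_eq: "J = insert None (Some ` K)" by blast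
    have A0: "A None \<in> sets geometry_algebra"
      using A True by (auto simp: sources_def)
    then have "A None \<subseteq> space M"
      using sets.sets_into_space by fastforce
    then have "\<Inter>(A ` J) = H \<inter> A None"
      unfolding J_eq H_def using B(2) by auto
    then have "prob (\<Inter>(A ` J)) = prob H * prob (A None)"
      using indep_setD[OF indep_fading_geometry H_sets A0] by simp
    also have "\<dots> = (\<Prod>j\<in>J. prob (A j))"
      unfolding J_eq using K by (simp add: H_prob prod.reindex mult.commute)
    finally show ?thesis .
  next
    case False
    have "j \<in> J \<longleftrightarrow> j \<in> Some ` K" for j
      using False by (cases j) (auto simp: K_def)
    then have J_eq: "J = Some ` K" by blast
    then have "\<Inter>(A ` J) = H"
      unfolding H_def using B(2) J(1) by auto
    then show ?thesis
      unfolding J_eq using K by (simp add: H_prob prod.reindex)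
  qed
qed

text \<open>The geometry and the fading of every link but \<open>v\<close>. This information
  determines the interference met by the server \<open>v\<close>, and with it both coverage
  thresholds.\<close>

definition without :: "lane \<times> nat \<Rightarrow> 'w measure" where
  "without v = sigma (space M) (\<Union>j\<in>- {Some v}. sources j)"

lemma sources_subset: "sources j \<subseteq> Pow (space M)"
  using indep_sources sets.space_closed unfolding indep_sets_def by blast

lemma space_without[simp]: "space (without v) = space M"
  unfolding without_def by (rule space_measure_of) (use sources_subset in blast)

lemma sets_without: "sets (without v) = sigma_sets (space M) (\<Union>j\<in>- {Some v}. sources j)"
  unfolding without_def by (rule sets_measure_of) (use sources_subset in blast)

lemma measurable_without:
  assumes "v \<in> A"
  shows "measurable_configuration (without v) X m h A"
proof
  have "sets geometry_algebra \<subseteq> sets (without v)"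
  proof
    fix S assume "S \<in> sets geometry_algebra"
    then have "S \<in> (\<Union>j\<in>- {Some v}. sources j)"
      by (intro UN_I[of None]) (auto simp: sources_def)
    then show "S \<in> sets (without v)"
      unfolding sets_without by blast
  qed
  then show "X i n \<in> borel_measurable (without v)" "m i n \<in> borel_measurable (without v)" for i n
    using measurable_geometry_algebra[of i n] by (auto simp: measurable_def)
  fix u assume u: "u \<notin> A"
  show "h u \<in> borel_measurable (without v)"
  proof (rule measurableI)
    fix B :: "complex set" assume "B \<in> sets borel"
    then have "h u -` B \<inter> space M \<in> (\<Union>j\<in>- {Some v}. sources j)"
      using u assms by (intro UN_I[of "Some u"]) (auto simp: sources_def)
    then show "h u -` B \<inter> space (without v) \<in> sets (without v)"
      unfolding sets_without space_without by blast
  qed simp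
qed

lemma sets_without_events:
  assumes "E \<in> sets (without v)"
  shows "E \<in> events"
proof -
  have "(\<Union>j\<in>- {Some v}. sources j) \<subseteq> events"
    using indep_sources unfolding indep_sets_def by blast
  with assms show ?thesis
    unfolding sets_without using sets.sigma_sets_subset by blast
qed

text \<open>The generators are closed under intersection, so independence passes to the
  sigma-algebras generated by disjoint blocks of indices. The blocks here are
  \<open>{Some v}\<close> and its complement, labelled by the two truth values.\<close>

lemma prob_without:
  assumes E: "E \<in> sets (without v)" and B: "B \<in> sets borel"
  shows "prob (E \<inter> {\<omega> \<in> space M. h v \<omega> \<in> B}) = prob E * prob {\<omega> \<in> space M. h v \<omega> \<in> B}"
proof -
  define I where "I b = (if b then - {Some v} else {Some v})" for b
  have stable: "Int_stable (sources j)" for j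
  proof (cases j)
    case None
    then show ?thesis by (auto simp: sources_def Int_stable_def)
  next
    case (Some u)
    show ?thesis
    proof (rule Int_stableI)
      fix a b assume "a \<in> sources j" "b \<in> sources j"
      then obtain A B where "A \<in> sets borel" "a = h u -` A \<inter> space M"
          "B \<in> sets borel" "b = h u -` B \<inter> space M"
        using Some by (auto simp: sources_def)
      then have "a \<inter> b = h u -` (A \<inter> B) \<inter> space M" "A \<inter> B \<in> sets borel"
        by auto
      then show "a \<inter> b \<in> sources j"
        unfolding Some sources_def option.case by blast
    qed
  qed
  have "indep_sets sources (\<Union>b\<in>UNIV. I b)"
    by (rule indep_sets_mono_index[OF _ indep_sources]) simp
  then have "indep_sets (\<lambda>b. sigma_sets (space M) (\<Union>j\<in>I b. sources j)) UNIV"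
    by (rule indep_sets_collect_sigma) (auto simp: disjoint_family_on_def I_def stable)
  then have "indep_set (sigma_sets (space M) (\<Union>j\<in>I True. sources j))
      (sigma_sets (space M) (\<Union>j\<in>I False. sources j))"
    unfolding indep_set_def
    by (rule back_subst[of "\<lambda>F. indep_sets F UNIV"]) (rule ext, simp split: bool.split)
  moreover have "{\<omega> \<in> space M. h v \<omega> \<in> B} \<in> sigma_sets (space M) (\<Union>j\<in>I False. sources j)"
  proof -
    have "{\<omega> \<in> space M. h v \<omega> \<in> B} = h v -` B \<inter> space M" by blast
    then have "{\<omega> \<in> space M. h v \<omega> \<in> B} \<in> sources (Some v)"
      using B by (auto simp: sources_def)
    then show ?thesis
      by (intro sigma_sets.Basic) (simp add: I_def)
  qed
  moreover have "E \<in> sigma_sets (space M) (\<Union>j\<in>I True. sources j)"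
    using E by (simp add: I_def sets_without)
  ultimately show ?thesis
    by (metis indep_setD)
qed

section \<open>Almost sure finiteness of the interference\<close>

lemma nn_integral_fading: "(\<integral>\<^sup>+\<omega>. ennreal ((cmod (h u \<omega>))\<^sup>2) \<partial>M) = 1"
proof -
  have E: "expectation (\<lambda>\<omega>. (cmod (h u \<omega>))\<^sup>2) = 1"
    using exponential_distributed_expectation[OF _ fading_rayleigh] by simp
  \<comment> \<open>A function that is not integrable has integral 0 by convention, so the mean 1
    already implies integrability.\<close>
  then have "integrable M (\<lambda>\<omega>. (cmod (h u \<omega>))\<^sup>2)"
    using not_integrable_integral_eq by fastforce
  with E show ?thesis
    by (subst nn_integral_eq_integral) auto
qed

text \<open>The fading is independent of the position and has mean 1, so in the mean the factor
  disappears and a pure Poisson sum remains.\<close>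

lemma nn_integral_far_power:
  "(\<integral>\<^sup>+\<omega>. far_power \<alpha> (points \<omega>) (fading \<omega>) (i, n) \<partial>M) =
    (\<integral>\<^sup>+\<omega>. ennreal (if 2 \<le> \<bar>X i n \<omega>\<bar> then (\<bar>X i n \<omega>\<bar> / 2) powr (- \<alpha>) else 0) \<partial>M)"
proof -
  let ?f = "\<lambda>\<omega>. ennreal ((cmod (h (i, n) \<omega>))\<^sup>2)"
  let ?g = "\<lambda>\<omega>. ennreal (if 2 \<le> \<bar>X i n \<omega>\<bar> then (\<bar>X i n \<omega>\<bar> / 2) powr (- \<alpha>) else 0)"
  have f: "?f \<in> borel_measurable fading_algebra" and g: "?g \<in> borel_measurable geometry_algebra"
  proof -
    note [measurable] = measurable_fading_algebra measurable_geometry_algebra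
    show "?f \<in> borel_measurable fading_algebra" "?g \<in> borel_measurable geometry_algebra"
      by measurable
  qed
  have "sigma_sets (space M) {?f -` A \<inter> space M | A. A \<in> sets borel} \<subseteq> sets fading_algebra"
  proof -
    have "{?f -` A \<inter> space M | A. A \<in> sets borel} \<subseteq> sets fading_algebra"
      using measurable_sets[OF f] by auto
    from sets.sigma_sets_subset[OF this] show ?thesis
      by (simp only: space_algebras)
  qed
  moreover have "sigma_sets (space M) {?g -` A \<inter> space M | A. A \<in> sets borel} \<subseteq> sets geometry_algebra"
  proof -
    have "{?g -` A \<inter> space M | A. A \<in> sets borel} \<subseteq> sets geometry_algebra"
      using measurable_sets[OF g] by auto
    from sets.sigma_sets_subset[OF this] show ?thesis
      by (simp only: space_algebras)
  qed
  ultimately have "indep_set (sigma_sets (space M) {?f -` A \<inter> space M | A. A \<in> sets borel})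
      (sigma_sets (space M) {?g -` A \<inter> space M | A. A \<in> sets borel})"
    using indep_fading_geometry unfolding indep_sets2_eq by blast
  then have "indep_var borel ?f borel ?g"
    unfolding indep_var_eq by simp
  then have "indep_vars (\<lambda>_. borel) (case_bool ?f ?g) UNIV"
    unfolding indep_var_def by (rule back_subst[of "\<lambda>F. indep_vars F _ _"]) (auto split: bool.split)
  from indep_vars_nn_integral[OF _ this]
  have "(\<integral>\<^sup>+\<omega>. ?f \<omega> * ?g \<omega> \<partial>M) = (\<integral>\<^sup>+\<omega>. ?f \<omega> \<partial>M) * (\<integral>\<^sup>+\<omega>. ?g \<omega> \<partial>M)"
    by (simp add: UNIV_bool mult.commute)
  then show ?thesis
    unfolding far_power_def fst_conv snd_conv by (simp add: nn_integral_fading)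
qed

text \<open>Each lane has a finite mean and is therefore almost surely finite. Treating the lanes
  separately and adding afterwards works for every coupling of them.\<close>

lemma AE_far_power_finite:
  assumes "0 < lam" "1 < \<alpha>"
  shows "AE \<omega> in M. infsum (far_power \<alpha> (points \<omega>) (fading \<omega>)) UNIV < \<infinity>"
proof -
  have [measurable]: "(\<lambda>\<omega>. far_power \<alpha> (points \<omega>) (fading \<omega>) u) \<in> borel_measurable M" for u
    unfolding far_power_def by measurable
  have "AE \<omega> in M. (\<Sum>n. far_power \<alpha> (points \<omega>) (fading \<omega>) (i, n)) \<noteq> \<infinity>" for i
  proof (rule nn_integral_noteq_infinite)
    show "(\<integral>\<^sup>+\<omega>. (\<Sum>n. far_power \<alpha> (points \<omega>) (fading \<omega>) (i, n)) \<partial>M) \<noteq> \<infinity>"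
      using poisson_shot_noise_finite[OF points_poisson[of i] assms]
      by (simp add: nn_integral_suminf nn_integral_far_power less_top[symmetric])
  qed measurable
  from this[of Lane1] this[of Lane2] show ?thesis
  proof eventually_elim
    case (elim \<omega>)
    let ?F = "far_power \<alpha> (points \<omega>) (fading \<omega>)"
    have "u \<in> range (Pair Lane1) \<union> range (Pair Lane2)" for u :: "lane \<times> nat"
      by (cases u; cases "fst u") auto
    then have "infsum ?F UNIV = infsum ?F (range (Pair Lane1) \<union> range (Pair Lane2))"
      by (intro arg_cong[where f = "infsum ?F"]) blast
    also have "\<dots> = infsum ?F (range (Pair Lane1)) + infsum ?F (range (Pair Lane2))"
      by (intro infsum_Un_disjoint nonneg_summable_on_complete) auto
    also have "\<dots> = (\<Sum>n. ?F (Lane1, n)) + (\<Sum>n. ?F (Lane2, n))"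
      by (subst (1 2) infsum_reindex) (auto simp: inj_on_def infsum_ennreal_nat comp_def)
    finally show ?case
      using elim by (simp add: less_top[symmetric] ennreal_add_eq_top)
  qed
qed

lemma measurable_covered:
  assumes "0 < \<gamma>"
  shows "Measurable.pred M (\<lambda>\<omega>. covered ant \<alpha> w d \<gamma> \<rho> (points \<omega>) (marks \<omega>) (fading \<omega>) r)"
proof -
  have [measurable]: "(\<lambda>\<omega>. interference ant \<alpha> w d (points \<omega>) (marks \<omega>) (fading \<omega>) r {v})
      \<in> borel_measurable M" for v
  proof -
    interpret C: measurable_configuration M X m h "{v}"
      by unfold_locales auto
    show ?thesis by measurable
  qed
  note [measurable] = measurable_received_power
  show ?thesis unfolding covered_iff[OF assms] by measurable
qed

lemma prob_fading_between:
  assumes "0 \<le> p" "p < q"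
  shows "0 < prob {\<omega> \<in> space M. p < (cmod (h u \<omega>))\<^sup>2 \<and> (cmod (h u \<omega>))\<^sup>2 \<le> q}"
proof -
  let ?Z = "\<lambda>\<omega>. (cmod (h u \<omega>))\<^sup>2"
  have le: "prob {\<omega> \<in> space M. ?Z \<omega> \<le> a} = 1 - exp (- a)" if "0 \<le> a" for a
    using exponential_distributedD_le[OF fading_rayleigh that] by simp
  have "{\<omega> \<in> space M. p < ?Z \<omega> \<and> ?Z \<omega> \<le> q} = {\<omega> \<in> space M. ?Z \<omega> \<le> q} - {\<omega> \<in> space M. ?Z \<omega> \<le> p}"
    by auto
  also have "prob \<dots> = prob {\<omega> \<in> space M. ?Z \<omega> \<le> q} - prob {\<omega> \<in> space M. ?Z \<omega> \<le> p}"
    using assms by (intro finite_measure_Diff) auto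
  also have "\<dots> > 0"
    using assms by (simp add: le)
  finally show ?thesis .
qed

section \<open>Configurations in which the noise level decides about coverage\<close>

definition vehicles :: "(lane \<Rightarrow> real) \<Rightarrow> 'w \<Rightarrow> nat set" where
  "vehicles d \<omega> = {r \<in> matern_II (d Lane1) (points \<omega> Lane1) (marks \<omega> Lane1). X Lane1 r \<omega> \<in> {0..1}}"

lemma AE_locally_finite:
  assumes "0 < lam"
  shows "AE \<omega> in M. \<forall>i b. finite {n. \<bar>X i n \<omega>\<bar> \<le> b}"
proof -
  \<comment> \<open>A common null set exists for countably many bounds only; the real bound
    \<open>b\<close> is afterwards rounded up to a natural number.\<close>
  have "AE \<omega> in M. \<forall>i. \<forall>k::nat. finite {n. X i n \<omega> \<in> {- real k..real k}}"
    unfolding AE_all_countable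
    by (intro allI poisson_AE_finite[OF points_poisson assms]) auto
  then show ?thesis
  proof eventually_elim
    case (elim \<omega>)
    show ?case
    proof (intro allI)
      fix i and b :: real
      have "finite {n. X i n \<omega> \<in> {- real (nat \<lceil>b\<rceil>)..real (nat \<lceil>b\<rceil>)}}"
        using elim by blast
      moreover have "b \<le> real (nat \<lceil>b\<rceil>)"
        by linarith
      then have "{n. \<bar>X i n \<omega>\<bar> \<le> b} \<subseteq> {n. X i n \<omega> \<in> {- real (nat \<lceil>b\<rceil>)..real (nat \<lceil>b\<rceil>)}}"
        by (intro subsetI, unfold mem_Collect_eq atLeastAtMost_iff) linarith
      ultimately show "finite {n. \<bar>X i n \<omega>\<bar> \<le> b}"
        by (rule rev_finite_subset)
    qed
  qed
qed

text \<open>Being nearest is purely geometric, and the interference leaves out both links, so the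
  whole condition ignores the fading of \<open>v\<close> and of \<open>v'\<close>. It is thus an
  event of \<open>without v\<close> as well as of \<open>without v'\<close>, which allows
  independence to be used once for each link.\<close>

definition candidate_pair :: "antenna \<Rightarrow> real \<Rightarrow> real \<Rightarrow> (lane \<Rightarrow> real) \<Rightarrow>
    nat \<Rightarrow> lane \<times> nat \<Rightarrow> lane \<times> nat \<Rightarrow> 'w \<Rightarrow> bool" where
  "candidate_pair ant \<alpha> w d r v v' \<omega> \<longleftrightarrow>
     r \<in> vehicles d \<omega> \<and> nearest_adjacent ant w d (points \<omega>) (marks \<omega>) r v \<and> v' \<noteq> v \<and>
     (\<forall>u. nearest_adjacent ant w d (points \<omega>) (marks \<omega>) r u \<longrightarrow> u \<in> {v, v'}) \<and>
     interference ant \<alpha> w d (points \<omega>) (marks \<omega>) (fading \<omega>) r {v, v'} < \<infinity>"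

lemma candidate_pair_without:
  assumes "u \<in> {v, v'}"
  shows "Measurable.pred (without u) (candidate_pair ant \<alpha> w d r v v')"
proof -
  interpret W: measurable_configuration "without u" X m h "{v, v'}"
    by (rule measurable_without[OF assms])
  show ?thesis
    unfolding candidate_pair_def[abs_def] vehicles_def mem_Collect_eq by measurable
qed

text \<open>The event \<open>?E\<close> concerns the first lane alone and has positive probability.
  On it, outside a null set, the second lane supplies a nearest vehicle and the interference is
  finite, so some indices fit.\<close>

lemma candidate_pair_positive:
  assumes lam: "0 < lam" and d: "\<And>i. 0 < d i" and \<alpha>: "1 < \<alpha>"
  shows "\<exists>r v v'. 0 < prob {\<omega> \<in> space M. candidate_pair ant \<alpha> w d r v v' \<omega>}"
proof -
  let ?F = "\<lambda>(r, v, v'). {\<omega> \<in> space M. candidate_pair ant \<alpha> w d r v v' \<omega>}"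
  let ?E = "{\<omega> \<in> space M. isolated_point (X Lane1) (d Lane1) 0 \<omega>}"
  have "\<exists>i. 0 < prob (?F i)"
  proof (rule exists_positive_prob)
    show "?E \<in> events"
      by (rule predE[OF measurable_isolated_point[OF points_poisson lam]])
    show "0 < prob ?E"
      using lam by (subst prob_isolated_point[OF points_poisson lam d]) auto
    show "?F i \<in> events" for i
    proof -
      obtain r v v' where i: "i = (r, v, v')" by (cases i)
      have "{\<omega> \<in> space (without v). candidate_pair ant \<alpha> w d r v v' \<omega>} \<in> sets (without v)"
        by (rule predE[OF candidate_pair_without]) simp
      from sets_without_events[OF this] show ?thesis
        by (simp add: i)
    qed
    have "AE \<omega> in M. finite {n. X Lane1 n \<omega> \<in> {0 - d Lane1..<0} \<union> {0 + 1..<0 + 1 + d Lane1}}"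
      by (rule poisson_AE_finite[OF points_poisson lam]) auto
    then show "AE \<omega> in M. \<omega> \<in> ?E \<longrightarrow> (\<exists>i. \<omega> \<in> ?F i)"
      using AE_locally_finite[OF lam] AE_far_power_finite[OF lam \<alpha>]
        AE_matern_point_beyond[OF points_poisson lam d, of Lane2 Lane2 "\<lambda>\<omega>. marks \<omega> Lane2" 2]
    proof eventually_elim
      case (elim \<omega>)
      show ?case
      proof
        assume "\<omega> \<in> ?E"
        with isolated_point_matern[OF points_poisson lam _ elim(1) d]
        obtain r where r: "r \<in> matern_II (d Lane1) (points \<omega> Lane1) (marks \<omega> Lane1)" "X Lane1 r \<omega> \<in> {0..<0 + 1}"
          and \<omega>: "\<omega> \<in> space M"
          by blast
        \<comment> \<open>A point at 2 or beyond is in front of every receiver in the unit interval,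
          so it transmits in the semicircle case too.\<close>
        from elim(4) obtain n where "n \<in> matern_II (d Lane2) (points \<omega> Lane2) (marks \<omega> Lane2)" "2 \<le> X Lane2 n \<omega>"
          by blast
        with r have "(Lane2, n) \<in> transmitters ant w d (points \<omega>) (marks \<omega>) r"
          by (auto simp: transmitters_def location_def)
        from nearest_adjacent_exists[OF _ this] elim(2)
        obtain v where v: "nearest_adjacent ant w d (points \<omega>) (marks \<omega>) r v"
          by auto
        from nearest_adjacent_at_most_two[OF d v] obtain v' where v': "v' \<noteq> v"
          "\<forall>u. nearest_adjacent ant w d (points \<omega>) (marks \<omega>) r u \<longrightarrow> u \<in> {v, v'}"
          by blast
        have "{u. \<bar>points \<omega> (fst u) (snd u)\<bar> < 2} \<subseteq>
            (\<Union>i\<in>{Lane1, Lane2}. Pair i ` {n. \<bar>X i n \<omega>\<bar> \<le> 2})"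
        proof
          fix u assume "u \<in> {u. \<bar>points \<omega> (fst u) (snd u)\<bar> < 2}"
          then show "u \<in> (\<Union>i\<in>{Lane1, Lane2}. Pair i ` {n. \<bar>X i n \<omega>\<bar> \<le> 2})"
            by (cases u; cases "fst u") auto
        qed
        then have "finite {u. \<bar>points \<omega> (fst u) (snd u)\<bar> < 2}"
          by (rule finite_subset) (use elim(2) in simp)
        then have "interference ant \<alpha> w d (points \<omega>) (marks \<omega>) (fading \<omega>) r {v, v'} < \<infinity>"
          using \<alpha> r elim(3) by (intro interference_finite) auto
        then have "\<omega> \<in> ?F (r, v, v')"
          using v v' r \<omega> by (auto simp: candidate_pair_def vehicles_def)
        then show "\<exists>i. \<omega> \<in> ?F i" by blast
      qed
    qed
  qed
  then show ?thesis by auto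
qed

lemma pred_vehicles[measurable]: "Measurable.pred M (\<lambda>\<omega>. r \<in> vehicles d \<omega>)"
  unfolding vehicles_def mem_Collect_eq by measurable

lemma coverage_gap_bounds:
  assumes cand: "candidate_pair ant \<alpha> w d r v v' \<omega>" and w: "0 < w" and \<gamma>: "0 < \<gamma>"
    and \<rho>: "0 \<le> \<rho>1" "\<rho>1 < \<rho>2"
  shows "\<exists>p q :: rat. 0 \<le> p \<and> p < q \<and>
    ennreal \<gamma> * (interference ant \<alpha> w d (points \<omega>) (marks \<omega>) (fading \<omega>) r {v} + ennreal \<rho>1)
      \<le> ennreal (of_rat p * norm (location w (points \<omega>) r v) powr (- \<alpha>)) \<and>
    ennreal (of_rat q * norm (location w (points \<omega>) r v) powr (- \<alpha>))
      \<le> ennreal \<gamma> * (interference ant \<alpha> w d (points \<omega>) (marks \<omega>) (fading \<omega>) r {v} + ennreal \<rho>2)"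
proof -
  define I where "I = interference ant \<alpha> w d (points \<omega>) (marks \<omega>) (fading \<omega>) r {v}"
  define l where "l = norm (location w (points \<omega>) r v) powr (- \<alpha>)"
  \<comment> \<open>A candidate pair only bounds the interference without the rival; adding the
    finite power of \<open>v'\<close> bounds the one that the server sees.\<close>
  have "I \<le> interference ant \<alpha> w d (points \<omega>) (marks \<omega>) (fading \<omega>) r {v', v} +
      received_power \<alpha> w (points \<omega>) (fading \<omega>) r v'"
    unfolding I_def by (rule interference_insert_le)
  also have "\<dots> < \<infinity>"
    using cand by (auto simp: candidate_pair_def received_power_def insert_commute less_top[symmetric] ennreal_add_eq_top)
  finally obtain i where i: "0 \<le> i" "I = ennreal i"
    by (cases I) auto
  have "fst v = Lane2"
    using cand by (auto simp: candidate_pair_def nearest_adjacent_def is_arg_min_def)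
  then have "0 < norm (location w (points \<omega>) r v)"
    using norm_location_adjacent[of v w] w by (metis abs_of_pos less_le_trans)
  then have l: "0 < l"
    by (simp add: l_def)
  \<comment> \<open>The values that the squared fading of \<open>v\<close> must exceed for coverage
    under \<rho>1 and under \<rho>2. They differ because \<open>i\<close> is finite and
    \<open>l\<close> is positive.\<close>
  define a where "a = \<gamma> * (i + \<rho>1) / l"
  define b where "b = \<gamma> * (i + \<rho>2) / l"
  have ab: "0 \<le> a" "a < b"
    using i \<rho> \<gamma> l by (auto simp: a_def b_def divide_strict_right_mono)
  from of_rat_dense[OF ab(2)] obtain q where q: "a < real_of_rat q" "real_of_rat q < b" by blast
  from of_rat_dense[OF q(1)] obtain p where p: "a < real_of_rat p" "real_of_rat p < real_of_rat q" by blast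
  have "\<gamma> * (i + \<rho>1) \<le> of_rat p * l" "of_rat q * l \<le> \<gamma> * (i + \<rho>2)"
    using p(1) q(2) l by (auto simp: a_def b_def field_simps)
  then have "ennreal \<gamma> * (I + ennreal \<rho>1) \<le> ennreal (of_rat p * l)"
    "ennreal (of_rat q * l) \<le> ennreal \<gamma> * (I + ennreal \<rho>2)"
    using i \<gamma> \<rho> by (auto simp: ennreal_mult[symmetric] ennreal_leI simp flip: ennreal_plus)
  moreover have "0 \<le> p" "p < q"
    using p ab(1) by (auto simp: of_rat_less) (metis less_eq_real_def less_le_trans of_rat_less_eq of_rat_0 order.strict_trans1)
  ultimately show ?thesis
    unfolding I_def l_def by blast
qed

text \<open>
  The lanes may be coupled so that two vehicles of the second lane are equally near with positive
  probability. The fading of the rival \<open>v'\<close> is then forced to be so small that \<open>v'\<close> cannot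
  provide coverage under the noise \<open>\<rho>2\<close>, while the independent fading of \<open>v\<close> falls in between the two
  coverage thresholds; rational bounds make this interval independent of the fading of \<open>v\<close>.
\<close>

lemma coverage_gap_positive:
  assumes lam: "0 < lam" and d: "\<And>i. 0 < d i" and w: "0 < w" and \<alpha>: "1 < \<alpha>" and \<gamma>: "0 < \<gamma>"
    and \<rho>: "0 \<le> \<rho>1" "\<rho>1 < \<rho>2"
  shows "\<exists>r. 0 < prob {\<omega> \<in> space M. r \<in> vehicles d \<omega> \<and>
    covered ant \<alpha> w d \<gamma> \<rho>1 (points \<omega>) (marks \<omega>) (fading \<omega>) r \<and>
    \<not> covered ant \<alpha> w d \<gamma> \<rho>2 (points \<omega>) (marks \<omega>) (fading \<omega>) r}"
proof -
  obtain r v v' where pos: "0 < prob {\<omega> \<in> space M. candidate_pair ant \<alpha> w d r v v' \<omega>}"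
    using candidate_pair_positive[where ant = ant and w = w and d = d, OF lam d \<alpha>] by blast
  let ?E1 = "{\<omega> \<in> space M. candidate_pair ant \<alpha> w d r v v' \<omega>}"
  have "?E1 \<noteq> {}"
    using pos by (intro notI) simp
  then have v': "v' \<noteq> v"
    by (auto simp: candidate_pair_def)
  \<comment> \<open>In the second lane the rival is at distance at least \<open>w\<close>, so fading
    up to \<epsilon> yields a power of at most
    \<open>\<epsilon> * w powr (- \<alpha>) = \<gamma> * \<rho>2\<close>. The noise alone then
    denies it coverage, whatever its interference.\<close>
  define \<epsilon> where "\<epsilon> = \<gamma> * \<rho>2 * w powr \<alpha>"
  have \<epsilon>: "0 < \<epsilon>"
    using \<gamma> \<rho> w by (simp add: \<epsilon>_def)
  let ?B1 = "{z :: complex. (cmod z)\<^sup>2 \<le> \<epsilon>}"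
  let ?E2 = "{\<omega> \<in> space M. candidate_pair ant \<alpha> w d r v v' \<omega> \<and> (cmod (h v' \<omega>))\<^sup>2 \<le> \<epsilon>}"
  have "?E1 \<in> sets (without v')"
    using predE[OF candidate_pair_without[of v' v v']] by simp
  moreover have "?B1 \<in> sets borel"
    by measurable
  ultimately have "prob (?E1 \<inter> {\<omega> \<in> space M. h v' \<omega> \<in> ?B1}) = prob ?E1 * prob {\<omega> \<in> space M. h v' \<omega> \<in> ?B1}"
    by (rule prob_without)
  moreover have "0 < prob {\<omega> \<in> space M. h v' \<omega> \<in> ?B1}"
  proof -
    have "0 < prob {\<omega> \<in> space M. 0 < (cmod (h v' \<omega>))\<^sup>2 \<and> (cmod (h v' \<omega>))\<^sup>2 \<le> \<epsilon>}"
      by (rule prob_fading_between) (use \<epsilon> in auto)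
    also have "\<dots> \<le> prob {\<omega> \<in> space M. h v' \<omega> \<in> ?B1}"
      by (rule finite_measure_mono) auto
    finally show ?thesis .
  qed
  moreover have "?E1 \<inter> {\<omega> \<in> space M. h v' \<omega> \<in> ?B1} = ?E2"
    by blast
  ultimately have E2_pos: "0 < prob ?E2"
    using pos by simp
  interpret W: measurable_configuration "without v" X m h "{v}"
    by (rule measurable_without) simp
  have v'_without[measurable]: "h v' \<in> borel_measurable (without v)"
    by (rule W.measurable_h) (use v' in simp)
  note [measurable] = candidate_pair_without[of v v v', simplified]
  \<comment> \<open>As \<open>v'\<close> differs from \<open>v\<close>, the bound on the rival's
    fading is known to \<open>without v\<close>, so the fading of \<open>v\<close> is still free for
    the second use of independence.\<close>
  have rival_pred: "Measurable.pred (without v)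
      (\<lambda>\<omega>. candidate_pair ant \<alpha> w d r v v' \<omega> \<and> (cmod (h v' \<omega>))\<^sup>2 \<le> \<epsilon>)"
    by measurable
  define l where "l \<omega> = norm (location w (points \<omega>) r v) powr (- \<alpha>)" for \<omega>
  define I where "I \<omega> = interference ant \<alpha> w d (points \<omega>) (marks \<omega>) (fading \<omega>) r {v}" for \<omega>
  have l_meas[measurable]: "l \<in> borel_measurable (without v)"
  proof -
    note [measurable] = W.measurable_location(2)
    show ?thesis unfolding l_def[abs_def] by measurable
  qed
  have I_meas[measurable]: "I \<in> borel_measurable (without v)"
    unfolding I_def[abs_def] by (rule W.measurable_interference)
  define F where "F = (\<lambda>(p, q). {\<omega> \<in> space (without v).
    (candidate_pair ant \<alpha> w d r v v' \<omega> \<and> (cmod (h v' \<omega>))\<^sup>2 \<le> \<epsilon>) \<and>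
    (0 \<le> p \<and> p < q \<and> ennreal \<gamma> * (I \<omega> + ennreal \<rho>1) \<le> ennreal (real_of_rat p * l \<omega>) \<and>
     ennreal (real_of_rat q * l \<omega>) \<le> ennreal \<gamma> * (I \<omega> + ennreal \<rho>2))})"
  have F: "F i \<in> sets (without v)" for i
  proof -
    obtain p q where i: "i = (p, q)" by (cases i)
    note [measurable] = rival_pred
    show ?thesis
      unfolding F_def i split by measurable
  qed
  have E2: "?E2 \<in> events"
    using sets_without_events[OF predE[OF rival_pred]] by simp
  have "\<exists>i. 0 < prob (F i)"
  proof (rule exists_positive_prob[OF E2 E2_pos sets_without_events[OF F]])
    have "\<exists>i. \<omega> \<in> F i" if "\<omega> \<in> ?E2" for \<omega>
    proof -
      have "candidate_pair ant \<alpha> w d r v v' \<omega>" using that by blast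
      from coverage_gap_bounds[OF this w \<gamma> \<rho>, folded I_def l_def]
      have "\<exists>p q. \<omega> \<in> F (p, q)"
        using that unfolding F_def by simp
      then show ?thesis by blast
    qed
    then show "AE \<omega> in M. \<omega> \<in> ?E2 \<longrightarrow> (\<exists>i. \<omega> \<in> F i)"
      by (intro AE_I2) blast
  qed
  then obtain p q where pq_pos: "0 < prob (F (p, q))"
    by auto
  then have "F (p, q) \<noteq> {}"
    by (intro notI) simp
  then have pq: "0 \<le> p" "p < q"
    by (auto simp: F_def)
  let ?B2 = "{z :: complex. real_of_rat p < (cmod z)\<^sup>2 \<and> (cmod z)\<^sup>2 \<le> real_of_rat q}"
  have "prob (F (p, q) \<inter> {\<omega> \<in> space M. h v \<omega> \<in> ?B2}) = prob (F (p, q)) * prob {\<omega> \<in> space M. h v \<omega> \<in> ?B2}"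
    by (rule prob_without[OF F]) measurable
  also have "\<dots> > 0"
    using pq_pos prob_fading_between[of "of_rat p" "of_rat q" v] pq by (simp add: of_rat_less)
  finally have "0 < prob (F (p, q) \<inter> {\<omega> \<in> space M. h v \<omega> \<in> ?B2})" .
  also have "\<dots> \<le> prob {\<omega> \<in> space M. r \<in> vehicles d \<omega> \<and>
    covered ant \<alpha> w d \<gamma> \<rho>1 (points \<omega>) (marks \<omega>) (fading \<omega>) r \<and>
    \<not> covered ant \<alpha> w d \<gamma> \<rho>2 (points \<omega>) (marks \<omega>) (fading \<omega>) r}"
  proof (rule finite_measure_mono)
    note [measurable] = measurable_covered[OF \<gamma>]
    show "{\<omega> \<in> space M. r \<in> vehicles d \<omega> \<and>
      covered ant \<alpha> w d \<gamma> \<rho>1 (points \<omega>) (marks \<omega>) (fading \<omega>) r \<and>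
      \<not> covered ant \<alpha> w d \<gamma> \<rho>2 (points \<omega>) (marks \<omega>) (fading \<omega>) r} \<in> events"
      by measurable
    show "F (p, q) \<inter> {\<omega> \<in> space M. h v \<omega> \<in> ?B2} \<subseteq> {\<omega> \<in> space M. r \<in> vehicles d \<omega> \<and>
      covered ant \<alpha> w d \<gamma> \<rho>1 (points \<omega>) (marks \<omega>) (fading \<omega>) r \<and>
      \<not> covered ant \<alpha> w d \<gamma> \<rho>2 (points \<omega>) (marks \<omega>) (fading \<omega>) r}"
    proof
      fix \<omega> assume \<omega>: "\<omega> \<in> F (p, q) \<inter> {\<omega> \<in> space M. h v \<omega> \<in> ?B2}"
      let ?I = "\<lambda>u. interference ant \<alpha> w d (points \<omega>) (marks \<omega>) (fading \<omega>) r {u}"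
      let ?R = "\<lambda>u. received_power \<alpha> w (points \<omega>) (fading \<omega>) r u"
      let ?l = "\<lambda>u. norm (location w (points \<omega>) r u) powr (- \<alpha>)"
      have cand: "candidate_pair ant \<alpha> w d r v v' \<omega>"
        and rival: "(cmod (h v' \<omega>))\<^sup>2 \<le> \<epsilon>"
        and lower: "ennreal \<gamma> * (?I v + ennreal \<rho>1) \<le> ennreal (of_rat p * ?l v)"
        and upper: "ennreal (of_rat q * ?l v) \<le> ennreal \<gamma> * (?I v + ennreal \<rho>2)"
        and hv: "of_rat p < (cmod (h v \<omega>))\<^sup>2" "(cmod (h v \<omega>))\<^sup>2 \<le> of_rat q"
        using \<omega> by (auto simp: F_def I_def l_def)
      have Lane2: "fst u = Lane2" if "nearest_adjacent ant w d (points \<omega>) (marks \<omega>) r u" for u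
        using that by (auto simp: nearest_adjacent_def is_arg_min_def)
      have near: "nearest_adjacent ant w d (points \<omega>) (marks \<omega>) r v"
        using cand by (simp add: candidate_pair_def)
      have "0 < norm (location w (points \<omega>) r v)"
        using norm_location_adjacent[OF Lane2[OF near], of w] w by (metis abs_of_pos less_le_trans)
      then have l: "0 < ?l v"
        by simp
      have "ennreal (of_rat p * ?l v) < ?R v"
        unfolding received_power_def using hv(1) l pq(1)
        by (intro ennreal_lessI mult_strict_right_mono mult_pos_pos) (auto intro: le_less_trans[of 0 "of_rat p"])
      with lower have "ennreal \<gamma> * (?I v + ennreal \<rho>1) < ?R v"
        by (rule le_less_trans)
      with near have cov: "covered ant \<alpha> w d \<gamma> \<rho>1 (points \<omega>) (marks \<omega>) (fading \<omega>) r"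
        unfolding covered_iff[OF \<gamma>] by blast
      have Rv: "?R v \<le> ennreal \<gamma> * (?I v + ennreal \<rho>2)"
      proof (rule order_trans[OF _ upper])
        show "?R v \<le> ennreal (of_rat q * ?l v)"
          unfolding received_power_def using hv(2) l by (intro ennreal_leI mult_right_mono) auto
      qed
      have Rv': "?R v' \<le> ennreal \<gamma> * (?I v' + ennreal \<rho>2)" if "fst v' = Lane2"
      proof -
        have "?l v' \<le> w powr (- \<alpha>)"
          using norm_location_adjacent[OF that, of w] w \<alpha> by (intro powr_mono2') auto
        then have "(cmod (h v' \<omega>))\<^sup>2 * ?l v' \<le> \<epsilon> * w powr (- \<alpha>)"
          using rival \<epsilon> by (intro mult_mono) auto
        also have "\<dots> = \<gamma> * \<rho>2"
          using w by (simp add: \<epsilon>_def mult.assoc flip: powr_add)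
        finally have "?R v' \<le> ennreal (\<gamma> * \<rho>2)"
          unfolding received_power_def by (rule ennreal_leI)
        also have "\<dots> = ennreal \<gamma> * ennreal \<rho>2"
          using \<gamma> \<rho> by (simp add: ennreal_mult)
        also have "\<dots> \<le> ennreal \<gamma> * (?I v' + ennreal \<rho>2)"
          by (intro mult_left_mono) auto
        finally show ?thesis .
      qed
      have "\<not> covered ant \<alpha> w d \<gamma> \<rho>2 (points \<omega>) (marks \<omega>) (fading \<omega>) r"
      proof
        assume "covered ant \<alpha> w d \<gamma> \<rho>2 (points \<omega>) (marks \<omega>) (fading \<omega>) r"
        then obtain u where u: "nearest_adjacent ant w d (points \<omega>) (marks \<omega>) r u"
          "ennreal \<gamma> * (?I u + ennreal \<rho>2) < ?R u"
          unfolding covered_iff[OF \<gamma>] by blast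
        then have "u = v \<or> u = v'"
          using cand u(1) unfolding candidate_pair_def by blast
        with u Rv Rv' Lane2 show False
          using not_less by blast
      qed
      with cov cand \<omega> show "\<omega> \<in> {\<omega> \<in> space M. r \<in> vehicles d \<omega> \<and>
          covered ant \<alpha> w d \<gamma> \<rho>1 (points \<omega>) (marks \<omega>) (fading \<omega>) r \<and>
          \<not> covered ant \<alpha> w d \<gamma> \<rho>2 (points \<omega>) (marks \<omega>) (fading \<omega>) r}"
        by (simp add: candidate_pair_def)
    qed
  qed
  finally show ?thesis by blast
qed

section \<open>From single configurations to the coverage probability\<close>

definition covered_vehicles :: "antenna \<Rightarrow> real \<Rightarrow> real \<Rightarrow> (lane \<Rightarrow> real) \<Rightarrow> real \<Rightarrow> real \<Rightarrow> 'w \<Rightarrow> nat set" where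
  "covered_vehicles ant \<alpha> w d \<gamma> \<rho> \<omega> =
     {r \<in> vehicles d \<omega>. covered ant \<alpha> w d \<gamma> \<rho> (points \<omega>) (marks \<omega>) (fading \<omega>) r}"

lemma coverage_probability_eq:
  "coverage_probability M X m h ant \<alpha> w d \<gamma> \<rho> =
     (\<integral>\<omega>. real (card (covered_vehicles ant \<alpha> w d \<gamma> \<rho> \<omega>)) \<partial>M) / (\<integral>\<omega>. real (card (vehicles d \<omega>)) \<partial>M)"
  by (simp add: coverage_probability_def covered_vehicles_def vehicles_def)

lemma covered_vehicles_subset: "covered_vehicles ant \<alpha> w d \<gamma> \<rho> \<omega> \<subseteq> vehicles d \<omega>"
  by (auto simp: covered_vehicles_def)

lemma AE_finite_vehicles:
  assumes "0 < lam"
  shows "AE \<omega> in M. finite (vehicles d \<omega>)"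
proof -
  have "AE \<omega> in M. finite {n. X Lane1 n \<omega> \<in> {0..1}}"
    by (rule poisson_AE_finite[OF points_poisson assms]) auto
  then show ?thesis
    by eventually_elim (auto simp: vehicles_def elim: rev_finite_subset)
qed

text \<open>The thinning only removes points, so the number of Poisson points of the first lane in
  the unit interval, with mean \<open>lam\<close>, is an integrable bound for numerator and
  denominator alike.\<close>

lemma integrable_card_subset_vehicles:
  assumes lam: "0 < lam" and S: "\<And>r. Measurable.pred M (\<lambda>\<omega>. r \<in> S \<omega>)" "\<And>\<omega>. S \<omega> \<subseteq> vehicles d \<omega>"
  shows "integrable M (\<lambda>\<omega>. real (card (S \<omega>)))"
proof -
  have "point_count (X Lane1) {0..1} \<in> M \<rightarrow>\<^sub>M count_space UNIV"
    by (rule measurable_point_count[OF points_poisson lam]) simp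
  then have meas: "(\<lambda>\<omega>. real (point_count (X Lane1) {0..1} \<omega>)) \<in> borel_measurable M"
    by (rule measurable_compose) simp
  have "(\<integral>\<^sup>+\<omega>. ennreal (real (point_count (X Lane1) {0..1} \<omega>)) \<partial>M) < \<infinity>"
    using nn_integral_point_count[OF points_poisson lam, of "{0..1}" Lane1]
    by (simp add: ennreal_of_nat_eq_real_of_nat)
  then have "integrable M (\<lambda>\<omega>. real (point_count (X Lane1) {0..1} \<omega>))"
    using meas by (intro integrableI_nonneg) auto
  then show ?thesis
  proof (rule Bochner_Integration.integrable_bound)
    have "(\<lambda>\<omega>. card (S \<omega>)) \<in> M \<rightarrow>\<^sub>M count_space UNIV"
      using S(1) by (intro measurable_card) (auto simp: pred_def)
    then show "(\<lambda>\<omega>. real (card (S \<omega>))) \<in> borel_measurable M"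
      by (rule measurable_compose) simp
    have "AE \<omega> in M. finite {n. X Lane1 n \<omega> \<in> {0..1}}"
      by (rule poisson_AE_finite[OF points_poisson lam]) auto
    then show "AE \<omega> in M. norm (real (card (S \<omega>))) \<le> norm (real (point_count (X Lane1) {0..1} \<omega>))"
    proof eventually_elim
      case (elim \<omega>)
      have "S \<omega> \<subseteq> {n. X Lane1 n \<omega> \<in> {0..1}}"
        using S(2)[of \<omega>] by (auto simp: vehicles_def)
      then have "card (S \<omega>) \<le> point_count (X Lane1) {0..1} \<omega>"
        unfolding point_count_def by (rule card_mono[OF elim])
      then show ?case by simp
    qed
  qed
qed

context
  fixes ant :: antenna and \<alpha> w \<gamma> :: real and d :: "lane \<Rightarrow> real"
  assumes lam_pos: "0 < lam" and \<gamma>_pos: "0 < \<gamma>"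
begin

abbreviation "V \<omega> \<equiv> real (card (vehicles d \<omega>))"
abbreviation "K \<rho> \<omega> \<equiv> real (card (covered_vehicles ant \<alpha> w d \<gamma> \<rho> \<omega>))"

lemma pred_covered_vehicles:
  "Measurable.pred M (\<lambda>\<omega>. r \<in> covered_vehicles ant \<alpha> w d \<gamma> \<rho> \<omega>)"
proof -
  note [measurable] = measurable_covered[OF \<gamma>_pos]
  show ?thesis
    unfolding covered_vehicles_def mem_Collect_eq by measurable
qed

lemma integrable_vehicles: "integrable M V"
  by (rule integrable_card_subset_vehicles[OF lam_pos pred_vehicles order_refl])

lemma integrable_covered_vehicles: "integrable M (K \<rho>)"
  by (rule integrable_card_subset_vehicles[OF lam_pos pred_covered_vehicles covered_vehicles_subset])

lemma AE_covered_vehicles_mono: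
  assumes "\<rho>1 \<le> \<rho>2"
  shows "AE \<omega> in M. K \<rho>2 \<omega> \<le> K \<rho>1 \<omega>"
  using AE_finite_vehicles[OF lam_pos, of d]
proof eventually_elim
  case (elim \<omega>)
  have "covered_vehicles ant \<alpha> w d \<gamma> \<rho>2 \<omega> \<subseteq> covered_vehicles ant \<alpha> w d \<gamma> \<rho>1 \<omega>"
    using covered_antimono[OF \<gamma>_pos assms] by (auto simp: covered_vehicles_def)
  with elim show ?case
    by (auto intro!: card_mono finite_subset[OF covered_vehicles_subset])
qed

lemma coverage_probability_antimono:
  assumes "\<rho>1 \<le> \<rho>2"
  shows "coverage_probability M X m h ant \<alpha> w d \<gamma> \<rho>2 \<le> coverage_probability M X m h ant \<alpha> w d \<gamma> \<rho>1"
  unfolding coverage_probability_eq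
  by (intro divide_right_mono integral_mono_AE integrable_covered_vehicles AE_covered_vehicles_mono assms)
     simp

lemma coverage_probability_strict_antimono:
  assumes "\<And>i. 0 < d i" "0 < w" "1 < \<alpha>" "0 \<le> \<rho>1" "\<rho>1 < \<rho>2"
  shows "coverage_probability M X m h ant \<alpha> w d \<gamma> \<rho>2 < coverage_probability M X m h ant \<alpha> w d \<gamma> \<rho>1"
proof -
  obtain r where r: "0 < prob {\<omega> \<in> space M. r \<in> vehicles d \<omega> \<and>
    covered ant \<alpha> w d \<gamma> \<rho>1 (points \<omega>) (marks \<omega>) (fading \<omega>) r \<and>
    \<not> covered ant \<alpha> w d \<gamma> \<rho>2 (points \<omega>) (marks \<omega>) (fading \<omega>) r}" (is "0 < prob ?S")
    using coverage_gap_positive[where d = d and ant = ant, OF lam_pos assms(1-3) \<gamma>_pos assms(4,5)] by blast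
  have "(\<integral>\<omega>. K \<rho>2 \<omega> \<partial>M) < (\<integral>\<omega>. K \<rho>1 \<omega> \<partial>M)"
  proof (rule integral_less_AE[where A = ?S, OF integrable_covered_vehicles integrable_covered_vehicles])
    show "emeasure M ?S \<noteq> 0"
      using r by (simp add: emeasure_eq_measure)
    show "?S \<in> sets M"
    proof -
      note [measurable] = measurable_covered[OF \<gamma>_pos]
      show ?thesis by measurable
    qed
    show "AE \<omega> in M. \<omega> \<in> ?S \<longrightarrow> K \<rho>2 \<omega> \<noteq> K \<rho>1 \<omega>"
      using AE_finite_vehicles[OF lam_pos, of d]
    proof eventually_elim
      case (elim \<omega>)
      show ?case
      proof
        assume "\<omega> \<in> ?S"
        then have "covered_vehicles ant \<alpha> w d \<gamma> \<rho>2 \<omega> \<subset> covered_vehicles ant \<alpha> w d \<gamma> \<rho>1 \<omega>"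
          using covered_antimono[OF \<gamma>_pos less_imp_le[OF assms(5)]]
          unfolding covered_vehicles_def by blast
        from psubset_card_mono[OF finite_subset[OF covered_vehicles_subset elim] this]
        show "K \<rho>2 \<omega> \<noteq> K \<rho>1 \<omega>" by simp
      qed
    qed
    show "AE \<omega> in M. K \<rho>2 \<omega> \<le> K \<rho>1 \<omega>"
      using assms by (intro AE_covered_vehicles_mono) simp
  qed
  \<comment> \<open>The denominator is positive because it is at least the larger numerator, which
    strictly exceeds a nonnegative one.\<close>
  moreover have "0 \<le> (\<integral>\<omega>. K \<rho>2 \<omega> \<partial>M)"
    by (rule integral_nonneg_AE) simp
  moreover have "(\<integral>\<omega>. K \<rho>1 \<omega> \<partial>M) \<le> (\<integral>\<omega>. V \<omega> \<partial>M)"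
    using AE_finite_vehicles[OF lam_pos, of d]
    by (intro integral_mono_AE integrable_covered_vehicles integrable_vehicles, eventually_elim)
       (auto intro!: card_mono simp: covered_vehicles_def)
  ultimately show ?thesis
    unfolding coverage_probability_eq by (intro divide_strict_right_mono) linarith+
qed

lemma coverage_probability_tendsto:
  assumes \<rho>: "\<rho> \<longlonglongrightarrow> 0" "\<And>n. 0 \<le> \<rho> n"
  shows "(\<lambda>n. coverage_probability M X m h ant \<alpha> w d \<gamma> (\<rho> n)) \<longlonglongrightarrow> coverage_probability M X m h ant \<alpha> w d \<gamma> 0"
proof -
  have "(\<lambda>n. \<integral>\<omega>. K (\<rho> n) \<omega> \<partial>M) \<longlonglongrightarrow> (\<integral>\<omega>. K 0 \<omega> \<partial>M)"
  proof (rule integral_dominated_convergence[where w = V])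
    show "AE \<omega> in M. norm (K (\<rho> n) \<omega>) \<le> V \<omega>" for n
      using AE_finite_vehicles[OF lam_pos, of d]
      by eventually_elim (auto intro!: card_mono simp: covered_vehicles_def)
    \<comment> \<open>Only finitely many vehicles are covered at noise 0, and each remains covered
      from some \<open>n\<close> on. Antitonicity excludes additional ones, so the count is
      eventually constant.\<close>
    show "AE \<omega> in M. (\<lambda>n. K (\<rho> n) \<omega>) \<longlonglongrightarrow> K 0 \<omega>"
      using AE_finite_vehicles[OF lam_pos, of d]
    proof eventually_elim
      case (elim \<omega>)
      have "\<forall>\<^sub>F n in sequentially. \<forall>r\<in>covered_vehicles ant \<alpha> w d \<gamma> 0 \<omega>.
          covered ant \<alpha> w d \<gamma> (\<rho> n) (points \<omega>) (marks \<omega>) (fading \<omega>) r"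
        using covered_zero_imp_eventually[OF \<gamma>_pos _ \<rho>(1)] finite_subset[OF covered_vehicles_subset elim]
        by (intro eventually_ball_finite) (auto simp: covered_vehicles_def)
      then have "\<forall>\<^sub>F n in sequentially. K (\<rho> n) \<omega> = K 0 \<omega>"
      proof eventually_elim
        case (elim n)
        then have "covered_vehicles ant \<alpha> w d \<gamma> (\<rho> n) \<omega> = covered_vehicles ant \<alpha> w d \<gamma> 0 \<omega>"
          using covered_antimono[OF \<gamma>_pos \<rho>(2)[of n]] unfolding covered_vehicles_def by blast
        then show ?case by simp
      qed
      then show ?case
        by (rule tendsto_eventually)
    qed
  qed (use integrable_vehicles integrable_covered_vehicles in auto)
  then show ?thesis
    unfolding coverage_probability_eq divide_inverse by (intro tendsto_mult_right)
qed

text \<open>With positive \<open>N\<close>, \<open>P\<close> and \<open>C\<close> the noise ratio is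
  never 0, so the value at 0 is only approached. The choice \<open>(1 / real (Suc n), 1, 1)\<close>
  realises a sequence of ratios tending to 0.\<close>

lemma coverage_probability_zero_eq_SUP:
  "coverage_probability M X m h ant \<alpha> w d \<gamma> 0 =
     (SUP (N, P, C) \<in> {0<..} \<times> {0<..} \<times> {0<..}. coverage_probability M X m h ant \<alpha> w d \<gamma> (N / (P * C)))"
  (is "?F 0 = (SUP t \<in> ?S. ?G t)")
proof (rule antisym)
  have le: "?G t \<le> ?F 0" if "t \<in> ?S" for t
    using that by (auto intro!: coverage_probability_antimono)
  have lim: "(\<lambda>n. ?F (1 / real (Suc n))) \<longlonglongrightarrow> ?F 0"
    by (rule coverage_probability_tendsto[OF LIMSEQ_Suc[OF lim_1_over_n]]) simp
  have bound: "?F (1 / real (Suc n)) \<le> (SUP t \<in> ?S. ?G t)" for n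
  proof -
    have "?G (1 / real (Suc n), 1, 1) \<le> (SUP t \<in> ?S. ?G t)"
      using le by (intro cSUP_upper bdd_aboveI2) auto
    then show ?thesis by simp
  qed
  show "?F 0 \<le> (SUP t \<in> ?S. ?G t)"
    by (rule LIMSEQ_le_const2[OF lim]) (use bound in blast)
  have "(1, 1, 1) \<in> ?S" by simp
  then show "(SUP t \<in> ?S. ?G t) \<le> ?F 0"
    using le by (intro cSUP_least) blast+
qed

end

end

text \<open>Being inversely proportional is read as decreasing in the noise ratio: a literal nonzero
  multiple of \<open>1 / \<rho>\<close> would be unbounded near 0, in conflict with a finite upper
  limit there. The supremum over all positive noise powers, transmit powers and path losses says
  that the value at 0 is the least upper bound.\<close>

theorem mainTheorem3:
  fixes M :: "'w measure"
    and X m :: "lane \<Rightarrow> nat \<Rightarrow> 'w \<Rightarrow> real"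
    and h :: "lane \<times> nat \<Rightarrow> 'w \<Rightarrow> complex"
    and d :: "lane \<Rightarrow> real"
    and lambda_p w_l \<alpha> \<gamma>\<^sub>t :: real
    and ant :: antenna
  assumes model: "two_lane_model M lambda_p X m h"
    and "0 < lambda_p" and "\<And>i. 0 < d i" and "0 < w_l"
    and heavy_traffic: "\<And>i. 1 \<le> lambda_p * d i"
    and "0 < \<alpha>" and "0 < \<gamma>\<^sub>t"
  shows "let F = coverage_probability M X m h ant \<alpha> w_l d \<gamma>\<^sub>t in
           antimono_on {0..} F \<and>
           (1 < \<alpha> \<longrightarrow> strict_antimono_on {0..} F) \<and>
           F 0 = (SUP (N, P\<^sub>t, C) \<in> {0<..} \<times> {0<..} \<times> {0<..}. F (N / (P\<^sub>t * C)))"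
proof -
  interpret two_lane_model M lambda_p X m h by (rule model)
  note params = \<open>0 < lambda_p\<close> \<open>0 < \<gamma>\<^sub>t\<close>
  show ?thesis
    unfolding Let_def
  proof (intro conjI impI)
    show "antimono_on {0..} (coverage_probability M X m h ant \<alpha> w_l d \<gamma>\<^sub>t)"
      by (intro monotone_onI coverage_probability_antimono[OF params])
    show "strict_antimono_on {0..} (coverage_probability M X m h ant \<alpha> w_l d \<gamma>\<^sub>t)" if "1 < \<alpha>"
      using coverage_probability_strict_antimono[where d = d, OF params assms(3,4) that]
      by (intro monotone_onI) simp
    show "coverage_probability M X m h ant \<alpha> w_l d \<gamma>\<^sub>t 0 =
        (SUP (N, P\<^sub>t, C) \<in> {0<..} \<times> {0<..} \<times> {0<..}. coverage_probability M X m h ant \<alpha> w_l d \<gamma>\<^sub>t (N / (P\<^sub>t * C)))"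
      by (rule coverage_probability_zero_eq_SUP[OF params])
  qed
qed

end
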